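(* The compact manifold $M^6=S_{1,\frac{\pi}{2}}/\Gamma$ carries a left-invariant (non-trivial) twisted generalized Kähler structure.
   Context: The group. $S_{1,\frac{\pi}{2}}$ is the simply-connected solvable Lie group whose Lie algebra has a basis of left-invariant 1-forms $e^1,\dots,e^6$ with structure equations $$de^1=e^1\wedge e^2,\quad de^2=0,\quad de^3=\tfrac12 e^2\wedge e^3,\quad de^4=\tfrac12 e^2\wedge e^4,\quad de^5=\tfrac{\pi}{2}e^2\wedge e^6,\quad de^6=-\tfrac{\pi}{2}e^2\wedge e^5.$$ The subgroup $\Gamma$ and the manifold $M^6$. Let $(m_{jk})\in SL(3,\mathbb{Z})$ be a matrix with two complex conjugate (non-real) eigenvalues $\alpha,\overline{\alpha}$ and an irrational eigenvalue $c>1$ such that $|\alpha|^2c=1$. Let $(\alpha_1,\alpha_2,\alpha_3)$ be an eigenvector corresponding to $\alpha$ and $(c_1,c_2,c_3)$ a real eigenvector corresponding to $c$, so that $(c\,c_j,\alpha\,\alpha_j)=\sum_{k=1}^3 m_{jk}(c_k,\alpha_k)$ for $j=1,2,3$; the vectors $(c_j,\alpha_j)$ are linearly independent over $\mathbb{R}$. The group $S_{1,\frac{\pi}{2}}$ is taken to be isomorphic to, and is identified with, $\mathbb{R}^6=\mathbb{R}\ltimes(\mathbb{R}\times\mathbb{C}\times\mathbb{C})$ with product $$(t,u,z,w)*(t',u',z',w')=(t+t',\,c^tu'+u,\,\alpha^tz'+z,\,e^{i\frac{\pi}{2}t}w'+w).$$ Under this identification $\Gamma\cong\mathbb{Z}\ltimes(\mathbb{Z}^3\times\mathbb{Z}^2)$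 is the uniform discrete subgroup of $S_{1,\frac{\pi}{2}}$ generated by the transformations $$g_0:(t,u,z,w)\mapsto(t+1,cu,\alpha z,iw),\qquad g_j:(t,u,z,w)\mapsto(t,u+c_j,z+\alpha_j,w)\ (j=1,2,3),$$ $$g_4:(t,u,z,w)\mapsto(t,u,z,w+1),\qquad g_5:(t,u,z,w)\mapsto(t,u,z,w+i),$$ and $M^6=S_{1,\frac{\pi}{2}}/\Gamma$ is the compact quotient. Left-invariant means induced by left-invariant tensors on $S_{1,\frac{\pi}{2}}$. Generalized Kähler structures. A generalized Kähler structure on an even-dimensional manifold $M$ is (equivalently) a triple $(J_+,J_-,g)$, where $J_\pm$ are integrable almost complex structures on $M$ and $g$ is a Riemannian metric Hermitian with respect to both $J_+$ and $J_-$, such that, with $F_\pm(\cdot,\cdot)=g(J_\pm\cdot,\cdot)$ and $d^c_\pm=i(\overline{\partial}_\pm-\partial_\pm)$, $$d^c_+F_++d^c_-F_-=0,\qquad d(d^c_+F_+)=0,\qquad d(d^c_-F_-)=0.$$ It is non-trivial if $J_-\neq\pm J_+$, i.e. if it does not arise from a Kähler structure $(J,g)$ by taking $J_+=J$, $J_-=\pm J$. The closed 3-form $H=d^c_+F_+=-d^c_-F_-$ is its torsion; the structure is twisted if $[H]\neq0$ in $H^3(M,\mathbb{R})$ and untwisted if $[H]=0$.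
   Formalization: The group is R^6 with the stated product; the printed structure equations are not imposed, since that product does not satisfy them: α is not real, so e^3, e^4 also rotate by Arg α, and de^5, de^6 differ by a factor ln c. *)

theory Defs
  imports "HOL-Analysis.Analysis" "HOL-Algebra.Generated_Groups"
begin

section \<open>Smooth maps and differential forms on a Euclidean space\<close>

fun differentiable_upto :: "nat \<Rightarrow> ('a::euclidean_space \<Rightarrow> 'b::real_normed_vector) \<Rightarrow> bool" where
  "differentiable_upto 0 f \<longleftrightarrow> continuous_on UNIV f"
| "differentiable_upto (Suc k) f \<longleftrightarrow>
     (\<forall>x. f differentiable (at x)) \<and>
     (\<forall>v. differentiable_upto k (\<lambda>x. frechet_derivative f (at x) v))"

definition smooth :: "('a::euclidean_space \<Rightarrow> 'b::real_normed_vector) \<Rightarrow> bool" where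
  "smooth f \<longleftrightarrow> (\<forall>k. differentiable_upto k f)"

text \<open>The value of a k-form at a point is a function of the list of its k arguments; it is
  set to 0 on lists of any other length, so that equality of forms is equality of functions.\<close>

type_synonym ('a, 'b) form = "'a \<Rightarrow> 'a list \<Rightarrow> 'b"

definition alternating :: "nat \<Rightarrow> ('a::real_vector list \<Rightarrow> 'b::real_vector) \<Rightarrow> bool" where
  "alternating k f \<longleftrightarrow>
     (\<forall>vs. length vs \<noteq> k \<longrightarrow> f vs = 0) \<and>
     (\<forall>vs i. length vs = k \<and> i < k \<longrightarrow> linear (\<lambda>v. f (vs[i := v]))) \<and>
     (\<forall>vs i j. length vs = k \<and> i < j \<and> j < k \<and> vs ! i = vs ! j \<longrightarrow> f vs = 0)"

definition ext_deriv ::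
  "('a::euclidean_space, 'b::real_normed_vector) form \<Rightarrow> ('a, 'b) form" where
  "ext_deriv \<omega> x vs =
     (\<Sum>i<length vs. (- 1) ^ i *\<^sub>R
        frechet_derivative (\<lambda>y. \<omega> y (take i vs @ drop (Suc i) vs)) (at x) (vs ! i))"

definition pullback ::
  "('a::euclidean_space \<Rightarrow> 'a) \<Rightarrow> ('a, 'b) form \<Rightarrow> ('a, 'b) form" where
  "pullback \<phi> \<omega> x vs = \<omega> (\<phi> x) (map (frechet_derivative \<phi> (at x)) vs)"

text \<open>If a group D of diffeomorphisms acts freely and properly discontinuously, then
  tensor fields on the quotient manifold are, through the covering projection, the same thing
  as D-invariant tensor fields upstairs, and this identification is compatible with the
  exterior derivative. Accordingly, all tensors on the quotient are represented by D-invariant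
  ones, and the sets below compute its real de Rham cohomology.\<close>

definition quotient_forms :: "('a::euclidean_space \<Rightarrow> 'a) set \<Rightarrow> nat \<Rightarrow> ('a, real) form set" where
  "quotient_forms D k = {\<omega>.
     (\<forall>x. alternating k (\<omega> x)) \<and>
     (\<forall>vs. smooth (\<lambda>x. \<omega> x vs)) \<and>
     (\<forall>\<phi>\<in>D. pullback \<phi> \<omega> = \<omega>)}"

definition closed_forms :: "('a::euclidean_space \<Rightarrow> 'a) set \<Rightarrow> nat \<Rightarrow> ('a, real) form set" where
  "closed_forms D k = {\<omega> \<in> quotient_forms D k. ext_deriv \<omega> = (\<lambda>x vs. 0)}"

definition exact_forms :: "('a::euclidean_space \<Rightarrow> 'a) set \<Rightarrow> nat \<Rightarrow> ('a, real) form set" where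
  "exact_forms D k = (case k of 0 \<Rightarrow> {\<lambda>x vs. 0} | Suc l \<Rightarrow> ext_deriv ` quotient_forms D l)"


section \<open>Complex structures and the operator \<open>d\<^sup>c\<close>\<close>

type_synonym 'a endo_field = "'a \<Rightarrow> 'a \<Rightarrow> 'a"

definition almost_complex :: "'a::euclidean_space endo_field \<Rightarrow> bool" where
  "almost_complex J \<longleftrightarrow>
     (\<forall>x. linear (J x)) \<and> (\<forall>x v. J x (J x v) = - v) \<and> (\<forall>v. smooth (\<lambda>x. J x v))"

definition lie_bracket ::
  "('a::euclidean_space \<Rightarrow> 'a) \<Rightarrow> ('a \<Rightarrow> 'a) \<Rightarrow> 'a \<Rightarrow> 'a" where
  "lie_bracket X Y x = frechet_derivative Y (at x) (X x) - frechet_derivative X (at x) (Y x)"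

definition nijenhuis ::
  "'a::euclidean_space endo_field \<Rightarrow> ('a \<Rightarrow> 'a) \<Rightarrow> ('a \<Rightarrow> 'a) \<Rightarrow> 'a \<Rightarrow> 'a" where
  "nijenhuis J X Y x =
     (let JX = (\<lambda>y. J y (X y)); JY = (\<lambda>y. J y (Y y)) in
      lie_bracket JX JY x - J x (lie_bracket JX Y x) - J x (lie_bracket X JY x)
        - lie_bracket X Y x)"

text \<open>Integrability is the vanishing of the Nijenhuis tensor. It is a local condition, so
  testing it on all vector fields upstairs is the same as testing it on the quotient.\<close>

definition integrable_complex :: "'a::euclidean_space endo_field \<Rightarrow> bool" where
  "integrable_complex J \<longleftrightarrow>
     almost_complex J \<and> (\<forall>X Y. smooth X \<and> smooth Y \<longrightarrow> (\<forall>x. nijenhuis J X Y x = 0))"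

text \<open>Complex-multilinear extension: a pair \<open>(a, b)\<close> stands for the complexified vector
  \<open>a + i b\<close>.\<close>

fun complex_ext :: "('a list \<Rightarrow> complex) \<Rightarrow> ('a \<times> 'a) list \<Rightarrow> complex" where
  "complex_ext f [] = f []"
| "complex_ext f ((a, b) # ws) =
     complex_ext (\<lambda>vs. f (a # vs)) ws + \<i> * complex_ext (\<lambda>vs. f (b # vs)) ws"

text \<open>The (1,0) and (0,1) parts \<open>(v \<mp> i J v) / 2\<close> of a real vector.\<close>

definition part10 :: "('a::real_vector \<Rightarrow> 'a) \<Rightarrow> 'a \<Rightarrow> 'a \<times> 'a" where
  "part10 j v = ((1/2) *\<^sub>R v, - (1/2) *\<^sub>R j v)"

definition part01 :: "('a::real_vector \<Rightarrow> 'a) \<Rightarrow> 'a \<Rightarrow> 'a \<times> 'a" where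
  "part01 j v = ((1/2) *\<^sub>R v, (1/2) *\<^sub>R j v)"

definition type_part ::
  "'a::euclidean_space endo_field \<Rightarrow> nat \<Rightarrow> nat \<Rightarrow> ('a, complex) form \<Rightarrow> ('a, complex) form" where
  "type_part J p q \<omega> x vs =
     (if length vs = p + q then
        \<Sum>I | I \<subseteq> {..<p + q} \<and> card I = p.
          complex_ext (\<omega> x)
            (map (\<lambda>l. if l \<in> I then part10 (J x) (vs ! l) else part01 (J x) (vs ! l)) [0..<p + q])
      else 0)"

text \<open>Dolbeault operators on forms of degree \<open>k\<close>.\<close>

definition del ::
  "'a::euclidean_space endo_field \<Rightarrow> nat \<Rightarrow> ('a, complex) form \<Rightarrow> ('a, complex) form" where
  "del J k \<omega> x vs = (\<Sum>p\<le>k. type_part J (p + 1) (k - p) (ext_deriv (type_part J p (k - p) \<omega>)) x vs)"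

definition delbar ::
  "'a::euclidean_space endo_field \<Rightarrow> nat \<Rightarrow> ('a, complex) form \<Rightarrow> ('a, complex) form" where
  "delbar J k \<omega> x vs = (\<Sum>p\<le>k. type_part J p (k - p + 1) (ext_deriv (type_part J p (k - p) \<omega>)) x vs)"

definition complexify :: "('a, real) form \<Rightarrow> ('a, complex) form" where
  "complexify \<omega> x vs = complex_of_real (\<omega> x vs)"

definition dc ::
  "'a::euclidean_space endo_field \<Rightarrow> nat \<Rightarrow> ('a, real) form \<Rightarrow> ('a, complex) form" where
  "dc J k \<omega> x vs = \<i> * (delbar J k (complexify \<omega>) x vs - del J k (complexify \<omega>) x vs)"


section \<open>Generalized Kaehler structures\<close>

type_synonym 'a metric_field = "'a \<Rightarrow> 'a \<Rightarrow> 'a \<Rightarrow> real"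

definition riemannian_metric :: "'a::euclidean_space metric_field \<Rightarrow> bool" where
  "riemannian_metric g \<longleftrightarrow>
     (\<forall>x. bilinear (g x)) \<and> (\<forall>x v w. g x v w = g x w v) \<and>
     (\<forall>x v. v \<noteq> 0 \<longrightarrow> g x v v > 0) \<and> (\<forall>v w. smooth (\<lambda>x. g x v w))"

definition hermitian :: "'a::euclidean_space metric_field \<Rightarrow> 'a endo_field \<Rightarrow> bool" where
  "hermitian g J \<longleftrightarrow> (\<forall>x v w. g x (J x v) (J x w) = g x v w)"

definition fundamental_form ::
  "'a::euclidean_space metric_field \<Rightarrow> 'a endo_field \<Rightarrow> ('a, real) form" where
  "fundamental_form g J x vs = (case vs of [v, w] \<Rightarrow> g x (J x v) w | _ \<Rightarrow> 0)"

definition invariant_endo :: "('a::euclidean_space \<Rightarrow> 'a) set \<Rightarrow> 'a endo_field \<Rightarrow> bool" where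
  "invariant_endo D J \<longleftrightarrow>
     (\<forall>\<phi>\<in>D. \<forall>x v. J (\<phi> x) (frechet_derivative \<phi> (at x) v) = frechet_derivative \<phi> (at x) (J x v))"

definition invariant_metric :: "('a::euclidean_space \<Rightarrow> 'a) set \<Rightarrow> 'a metric_field \<Rightarrow> bool" where
  "invariant_metric D g \<longleftrightarrow>
     (\<forall>\<phi>\<in>D. \<forall>x v w.
        g (\<phi> x) (frechet_derivative \<phi> (at x) v) (frechet_derivative \<phi> (at x) w) = g x v w)"

definition generalized_kahler ::
  "('a::euclidean_space \<Rightarrow> 'a) set \<Rightarrow> 'a endo_field \<Rightarrow> 'a endo_field \<Rightarrow> 'a metric_field \<Rightarrow> bool" where
  "generalized_kahler D Jp Jm g \<longleftrightarrow>
     invariant_endo D Jp \<and> invariant_endo D Jm \<and> invariant_metric D g \<and>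
     integrable_complex Jp \<and> integrable_complex Jm \<and>
     riemannian_metric g \<and> hermitian g Jp \<and> hermitian g Jm \<and>
     (\<forall>x vs. dc Jp 2 (fundamental_form g Jp) x vs + dc Jm 2 (fundamental_form g Jm) x vs = 0) \<and>
     ext_deriv (dc Jp 2 (fundamental_form g Jp)) = (\<lambda>x vs. 0) \<and>
     ext_deriv (dc Jm 2 (fundamental_form g Jm)) = (\<lambda>x vs. 0)"

definition nontrivial_pair :: "'a::euclidean_space endo_field \<Rightarrow> 'a endo_field \<Rightarrow> bool" where
  "nontrivial_pair Jp Jm \<longleftrightarrow> Jm \<noteq> Jp \<and> Jm \<noteq> (\<lambda>x v. - Jp x v)"

text \<open>The torsion \<open>d\<^sup>c\<^sub>+ F\<^sub>+\<close> takes real values; it is regarded as a real form \<open>H\<close> in order to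
  speak of its class in real cohomology.\<close>

definition twisted ::
  "('a::euclidean_space \<Rightarrow> 'a) set \<Rightarrow> 'a endo_field \<Rightarrow> 'a metric_field \<Rightarrow> bool" where
  "twisted D Jp g \<longleftrightarrow>
     (\<exists>H \<in> closed_forms D 3.
        complexify H = dc Jp 2 (fundamental_form g Jp) \<and> H \<notin> exact_forms D 3)"


section \<open>The solvable group, the lattice and the quotient\<close>

type_synonym E6 = "real \<times> real \<times> complex \<times> complex"

text \<open>Complex powers use the principal branch. The group product is well defined for any
  \<open>c > 0\<close>, \<open>\<alpha> \<noteq> 0\<close>. With \<open>\<theta> = Arg \<alpha>\<close> and \<open>|\<alpha>|\<^sup>2 c = 1\<close>, the coframe
  \<open>e\<^sup>1 = c\<^sup>-\<^sup>t du\<close>, \<open>e\<^sup>2 = ln c dt\<close>, \<open>e\<^sup>3 + i e\<^sup>4 = \<alpha>\<^sup>-\<^sup>t dz\<close>,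
  \<open>e\<^sup>5 + i e\<^sup>6 = exp (- i \<pi> t / 2) dw\<close> is left-invariant and satisfies
  \<open>de\<^sup>1 = e\<^sup>1 \<and> e\<^sup>2\<close>, \<open>de\<^sup>2 = 0\<close>,
  \<open>de\<^sup>3 = 1/2 e\<^sup>2 \<and> e\<^sup>3 + \<theta> dt \<and> e\<^sup>4\<close>, \<open>de\<^sup>4 = 1/2 e\<^sup>2 \<and> e\<^sup>4 - \<theta> dt \<and> e\<^sup>3\<close>,
  \<open>de\<^sup>5 = \<pi>/2 dt \<and> e\<^sup>6\<close>, \<open>de\<^sup>6 = - \<pi>/2 dt \<and> e\<^sup>5\<close>. These are the structure equations
  \<open>de\<^sup>1 = e\<^sup>1 \<and> e\<^sup>2\<close>, \<open>de\<^sup>2 = 0\<close>, \<open>de\<^sup>3 = 1/2 e\<^sup>2 \<and> e\<^sup>3\<close>, \<open>de\<^sup>4 = 1/2 e\<^sup>2 \<and> e\<^sup>4\<close>,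
  \<open>de\<^sup>5 = \<pi>/2 e\<^sup>2 \<and> e\<^sup>6\<close>, \<open>de\<^sup>6 = - \<pi>/2 e\<^sup>2 \<and> e\<^sup>5\<close> of \<open>S\<^sub>1\<^sub>,\<^sub>\<pi>\<^sub>/\<^sub>2\<close> up to the scale
  \<open>ln c\<close> in the last two and the rotation by \<open>\<theta>\<close> in the \<open>e\<^sup>3, e\<^sup>4\<close> plane. Since the lattice
  lies in the group with the product below, that product is the definition used.\<close>

definition solv_mult :: "real \<Rightarrow> complex \<Rightarrow> E6 \<Rightarrow> E6 \<Rightarrow> E6" where
  "solv_mult c \<alpha> = (\<lambda>(t, u, z, w) (t', u', z', w').
     (t + t', c powr t * u' + u, \<alpha> powr complex_of_real t * z' + z,
      exp (\<i> * (pi / 2) * t) * w' + w))"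

definition solv_group :: "real \<Rightarrow> complex \<Rightarrow> E6 monoid" where
  "solv_group c \<alpha> = \<lparr>carrier = UNIV, monoid.mult = solv_mult c \<alpha>, one = (0, 0, 0, 0)\<rparr>"

lemma group_solv_group:
  assumes "c > 0" "\<alpha> \<noteq> 0"
  shows "group (solv_group c \<alpha>)"
proof (rule groupI)
  fix p assume "p \<in> carrier (solv_group c \<alpha>)"
  obtain t u z w where p: "p = (t, u, z, w)" by (cases p)
  define q where "q = (- t, - (c powr (-t) * u), - (\<alpha> powr complex_of_real (-t) * z),
                        - (exp (\<i> * (pi / 2) * complex_of_real (-t)) * w))"
  have "solv_mult c \<alpha> q p = (0, 0, 0, 0)"
    unfolding p q_def solv_mult_def prod.case by (simp only: prod.inject) simp
  then show "\<exists>q\<in>carrier (solv_group c \<alpha>). q \<otimes>\<^bsub>solv_group c \<alpha>\<^esub> p = \<one>\<^bsub>solv_group c \<alpha>\<^esub>"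
    by (intro bexI[of _ q]) (simp_all add: solv_group_def)
next
  fix p q r :: E6
  obtain t u z w where p: "p = (t, u, z, w)" by (cases p)
  obtain t' u' z' w' where q: "q = (t', u', z', w')" by (cases q)
  obtain t'' u'' z'' w'' where r: "r = (t'', u'', z'', w'')" by (cases r)
  have "c powr (t + t') = c powr t * c powr t'"
    by (rule powr_add)
  moreover have "\<alpha> powr complex_of_real (t + t') =
      \<alpha> powr complex_of_real t * \<alpha> powr complex_of_real t'"
    unfolding of_real_add by (rule powr_add)
  moreover have "exp (\<i> * (pi / 2) * complex_of_real (t + t')) =
      exp (\<i> * (pi / 2) * complex_of_real t) * exp (\<i> * (pi / 2) * complex_of_real t')"
    unfolding of_real_add distrib_left by (rule exp_add)
  ultimately have "solv_mult c \<alpha> (solv_mult c \<alpha> p q) r = solv_mult c \<alpha> p (solv_mult c \<alpha> q r)"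
    unfolding p q r solv_mult_def prod.case by (simp only: distrib_left mult.assoc add.assoc)
  then show "p \<otimes>\<^bsub>solv_group c \<alpha>\<^esub> q \<otimes>\<^bsub>solv_group c \<alpha>\<^esub> r = p \<otimes>\<^bsub>solv_group c \<alpha>\<^esub> (q \<otimes>\<^bsub>solv_group c \<alpha>\<^esub> r)"
    by (simp add: solv_group_def)
next
  fix p :: E6
  show "\<one>\<^bsub>solv_group c \<alpha>\<^esub> \<otimes>\<^bsub>solv_group c \<alpha>\<^esub> p = p"
    using assms by (cases p) (simp add: solv_group_def solv_mult_def)
qed (simp_all add: solv_group_def)

definition lattice_generators :: "real^3 \<Rightarrow> complex^3 \<Rightarrow> E6 set" where
  "lattice_generators cv \<alpha>v =
     {(1, 0, 0, 0), (0, 0, 0, 1), (0, 0, 0, \<i>)} \<union> range (\<lambda>j. (0, cv $ j, \<alpha>v $ j, 0))"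

text \<open>The generating transformations are the left translations by these elements.\<close>

lemma solv_mult_generators:
  assumes "c > 0" "\<alpha> \<noteq> 0"
  shows "solv_mult c \<alpha> (1, 0, 0, 0) (t, u, z, w) = (t + 1, c * u, \<alpha> * z, \<i> * w)"
    and "solv_mult c \<alpha> (0, cv $ j, \<alpha>v $ j, 0) (t, u, z, w) = (t, u + cv $ j, z + \<alpha>v $ j, w)"
    and "solv_mult c \<alpha> (0, 0, 0, 1) (t, u, z, w) = (t, u, z, w + 1)"
    and "solv_mult c \<alpha> (0, 0, 0, \<i>) (t, u, z, w) = (t, u, z, w + \<i>)"
proof -
  have "exp (\<i> * (pi / 2) * complex_of_real 1) = \<i>"
    by (simp add: exp_eq_polar flip: cis_conv_exp)
  then show "solv_mult c \<alpha> (1, 0, 0, 0) (t, u, z, w) = (t + 1, c * u, \<alpha> * z, \<i> * w)"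
    using assms unfolding solv_mult_def prod.case by (simp only: prod.inject) simp
qed (use assms in \<open>simp_all add: solv_mult_def\<close>)

definition solv_lattice :: "real \<Rightarrow> complex \<Rightarrow> real^3 \<Rightarrow> complex^3 \<Rightarrow> E6 set" where
  "solv_lattice c \<alpha> cv \<alpha>v = generate (solv_group c \<alpha>) (lattice_generators cv \<alpha>v)"

definition left_translations :: "real \<Rightarrow> complex \<Rightarrow> E6 set \<Rightarrow> (E6 \<Rightarrow> E6) set" where
  "left_translations c \<alpha> A = solv_mult c \<alpha> ` A"

text \<open>The orbit space of the action of \<open>\<Gamma>\<close> by left translations, with the quotient topology:
  the orbits are the cosets \<open>\<Gamma> #> x\<close>, and the union of a set of cosets is its preimage
  under the projection.\<close>

definition orbit_space :: "real \<Rightarrow> complex \<Rightarrow> E6 set \<Rightarrow> E6 set topology" where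
  "orbit_space c \<alpha> \<Gamma> = topology (\<lambda>U. U \<subseteq> rcosets\<^bsub>solv_group c \<alpha>\<^esub> \<Gamma> \<and> open (\<Union>U))"

definition left_invariant ::
  "real \<Rightarrow> complex \<Rightarrow> E6 endo_field \<Rightarrow> E6 endo_field \<Rightarrow> E6 metric_field \<Rightarrow> bool" where
  "left_invariant c \<alpha> Jp Jm g \<longleftrightarrow>
     (let L = left_translations c \<alpha> UNIV in
      invariant_endo L Jp \<and> invariant_endo L Jm \<and> invariant_metric L g)"

end

(* In the coordinates (t, u, z, w), with a = ln c, take the left-invariant metric
   g = c^(-2t) du^2 + a^2 dt^2 + c^t |dz|^2 + |dw|^2 and the left-invariant complex structures J_s,
   s = 1 or s = -1, which send dz to i s dz, dw to i dw and rotate the (t, u) plane. They are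
   integrable, dF_s = a s c^t dt dx dy for z = x + i y, and the (1,2) and (2,1) parts of this form give
   d^c F_s = s du dx dy, which has constant coefficients, so is closed, and changes sign with s.
   It is not exact on the quotient: it restricts to a nonzero multiple of the volume form on the
   torus t = 0, w = 0, and Stokes' theorem applies there. That the vectors (c_j, alpha_j) form a basis,
   and so that the lattice is discrete with compact quotient, follows from the distinctness of the
   eigenvalues. *)
theory Submission
  imports Defs
begin

section \<open>Smooth maps and exterior derivatives\<close>

text \<open>The weights are dictated by invariance. Left translation by a point with first
  coordinate t multiplies du by \<open>c^t\<close> and, since |\<alpha>|^2 c = 1, multiplies dx dy
  by \<open>c^(-t)\<close>; hence the compensating powers of c in the metric, while du dx dy is
  invariant as it stands. The rotations contained in \<open>\<alpha>^t\<close> and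
  \<open>exp (i pi t / 2)\<close> commute with i and preserve norms, so they leave no trace. The
  fundamental form is \<open>a c^(-t) dt du + s c^t dx dy\<close> plus a constant form in w. Its
  first term is closed because the coefficient depends on t alone, so reversing the orientation of
  the z factor, and of no other, is what changes the sign of the torsion. The obstacle is
  non-exactness: a primitive on the quotient is only \<Gamma>-invariant and may fail to be
  left-invariant, so linear algebra on left-invariant forms does not settle the matter. Three of the
  generators are ordinary translations, though, and invariance under them is periodicity; this
  reduces Stokes' theorem to Fubini and the fundamental theorem of calculus.\<close>

lemma differentiable_upto_exp_linear:
  fixes l :: "'a::euclidean_space \<Rightarrow> real" and v :: "'b::real_normed_vector"
  assumes "bounded_linear l"
  shows "differentiable_upto k (\<lambda>x. exp (l x) *\<^sub>R v)"
\<comment> \<open>A directional derivative has the same shape with a multiple of \<open>v\<close> in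
  place of \<open>v\<close>, so the induction generalizes over \<open>v\<close>. Sums of such terms
  cover all coefficients below.\<close>
proof (induction k arbitrary: v)
  case 0
  show ?case
    using linear_continuous_on[OF assms] by (simp add: continuous_on_exp continuous_on_scaleR)
next
  case (Suc k)
  have D: "((\<lambda>x. exp (l x) *\<^sub>R v) has_derivative (\<lambda>h. (exp (l x) * l h) *\<^sub>R v)) (at x)" for x
    by (rule derivative_eq_intros bounded_linear_imp_has_derivative[OF assms] refl | simp add: mult.commute)+
  then show ?case
    using Suc[of "l _ *\<^sub>R v"]
    by (auto simp: frechet_derivative_at[OF D, symmetric] differentiable_def)
qed

lemma differentiable_upto_add:
  assumes "differentiable_upto k f" "differentiable_upto k g"
  shows "differentiable_upto k (\<lambda>x. f x + g x)"
  using assms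
proof (induction k arbitrary: f g)
  case 0
  then show ?case by (simp add: continuous_on_add)
next
  case (Suc k)
  have "((\<lambda>x. f x + g x) has_derivative
      (\<lambda>v. frechet_derivative f (at x) v + frechet_derivative g (at x) v)) (at x)" for x
    using Suc.prems by (intro has_derivative_add frechet_derivative_works[THEN iffD1]) auto
  note D = frechet_derivative_at[OF this, symmetric]
  show ?case
    using Suc by (auto simp: D intro: differentiable_add)
qed

lemma smooth_exp_linear: "bounded_linear l \<Longrightarrow> smooth (\<lambda>x. exp (l x) *\<^sub>R v)"
  by (simp add: smooth_def differentiable_upto_exp_linear)

lemma smooth_const [simp]: "smooth (\<lambda>x. v)"
  using smooth_exp_linear[OF bounded_linear_zero, of v] by simp

lemma smooth_add: "smooth f \<Longrightarrow> smooth g \<Longrightarrow> smooth (\<lambda>x. f x + g x)"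
  by (simp add: smooth_def differentiable_upto_add)

lemma smooth_differentiable: "smooth f \<Longrightarrow> f differentiable (at x)"
  using differentiable_upto.simps(2)[of 0 f] by (auto simp: smooth_def)

lemma smooth_continuous_on_frechet_derivative:
  "smooth f \<Longrightarrow> continuous_on UNIV (\<lambda>x. frechet_derivative f (at x) v)"
  using differentiable_upto.simps(2)[of 0 f] by (auto simp: smooth_def)

lemma smooth_has_derivative:
  "smooth f \<Longrightarrow> (f has_derivative frechet_derivative f (at x)) (at x)"
  by (simp add: smooth_differentiable flip: frechet_derivative_works)

lemma ext_deriv_const: "ext_deriv (\<lambda>x. \<omega>) = (\<lambda>x vs. 0)"
  by (simp add: ext_deriv_def fun_eq_iff)

lemma ext_deriv_three:
  "ext_deriv \<omega> x [u, v, w] =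
     frechet_derivative (\<lambda>y. \<omega> y [v, w]) (at x) u -
     frechet_derivative (\<lambda>y. \<omega> y [u, w]) (at x) v +
     frechet_derivative (\<lambda>y. \<omega> y [u, v]) (at x) w"
  by (simp add: ext_deriv_def numeral_3_eq_3)

text \<open>The index sets in \<open>type_part\<close> for degrees two and three: the positions that
  receive the (1,0) projection.\<close>

lemma subsets_of_card:
  "{I. I \<subseteq> {..<2::nat} \<and> card I = 0} = {{}}"
  "{I. I \<subseteq> {..<2::nat} \<and> card I = 1} = {{0}, {1}}"
  "{I. I \<subseteq> {..<2::nat} \<and> card I = 2} = {{0, 1}}"
  "{I. I \<subseteq> {..<3::nat} \<and> card I = 1} = {{0}, {1}, {2}}"
  "{I. I \<subseteq> {..<3::nat} \<and> card I = 2} = {{0, 1}, {0, 2}, {1, 2}}"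
proof -
  have 2: "{..<2::nat} = {0, 1}" and 3: "{..<3::nat} = {0, 1, 2}"
    by auto
  have P2: "I \<subseteq> {..<2} \<longleftrightarrow> I \<in> {{}, {0}, {1}, {0, 1}}" for I :: "nat set"
    unfolding 2 Pow_iff[symmetric] by (simp only: Pow_insert Pow_empty) auto
  have P3: "I \<subseteq> {..<3} \<longleftrightarrow>
      I \<in> {{}, {0}, {1}, {2}, {0, 1}, {0, 2}, {1, 2}, {0, 1, 2}}" for I :: "nat set"
    unfolding 3 Pow_iff[symmetric] by (simp only: Pow_insert Pow_empty) auto
  show "{I. I \<subseteq> {..<2::nat} \<and> card I = 0} = {{}}"
    "{I. I \<subseteq> {..<2::nat} \<and> card I = 1} = {{0}, {1}}"
    "{I. I \<subseteq> {..<2::nat} \<and> card I = 2} = {{0, 1}}"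
    "{I. I \<subseteq> {..<3::nat} \<and> card I = 1} = {{0}, {1}, {2}}"
    "{I. I \<subseteq> {..<3::nat} \<and> card I = 2} = {{0, 1}, {0, 2}, {1, 2}}"
    unfolding P2 P3 by auto
qed

section \<open>The torsion of a (1,1)-form\<close>

lemma type_part_12:
  "type_part J 1 2 \<omega> x [u, v, w] =
     complex_ext (\<omega> x) [part10 (J x) u, part01 (J x) v, part01 (J x) w] +
     complex_ext (\<omega> x) [part01 (J x) u, part10 (J x) v, part01 (J x) w] +
     complex_ext (\<omega> x) [part01 (J x) u, part01 (J x) v, part10 (J x) w]"
proof -
  have 3: "(1::nat) + 2 = 3" "[0..<3] = [0, 1, 2::nat]" "length [u, v, w] = 3"
    by (simp_all add: numeral_3_eq_3)
  show ?thesis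
    unfolding type_part_def 3 subsets_of_card by simp
qed

lemma type_part_21:
  "type_part J 2 1 \<omega> x [u, v, w] =
     complex_ext (\<omega> x) [part10 (J x) u, part10 (J x) v, part01 (J x) w] +
     complex_ext (\<omega> x) [part10 (J x) u, part01 (J x) v, part10 (J x) w] +
     complex_ext (\<omega> x) [part01 (J x) u, part10 (J x) v, part10 (J x) w]"
proof -
  have 3: "(2::nat) + 1 = 3" "[0..<3] = [0, 1, 2::nat]" "length [u, v, w] = 3"
    by (simp_all add: numeral_3_eq_3)
  have "{0, 1} \<noteq> {0, 2::nat}" "{0, 1} \<noteq> {1, 2::nat}" "{0, 2} \<noteq> {1, 2::nat}"
    by (simp_all add: doubleton_eq_iff)
  then show ?thesis
    unfolding type_part_def 3 subsets_of_card by simp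
qed

text \<open>Letting J act on one argument, summed over the arguments, multiplies a form of type
  (p,q) by i(p - q); acting on all three multiplies it by i^(p - q). The combination with weights
  1/4 and 3/4 is i on (2,1), -i on (1,2) and 0 on (3,0) and (0,3), which is the negative of the
  operator that \<open>dc\<close> applies to dF. The formula thus avoids complex arguments.\<close>

lemma dc_two_of_type_11:
  fixes F :: "('a::euclidean_space, real) form"
  assumes F_len: "\<And>x vs. length vs \<noteq> 2 \<Longrightarrow> F x vs = 0"
    and F_bil: "\<And>x. bilinear (\<lambda>v w. F x [v, w])"
    and F_J: "\<And>x v w. F x [J x v, J x w] = F x [v, w]"
    and JJ: "\<And>x v. J x (J x v) = - v"
    and dF: "\<And>x u v w. ext_deriv (complexify F) x [u, v, w] = of_real (\<theta> x u v w)"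
    and lin: "\<And>x v w. linear (\<lambda>u. \<theta> x u v w)" "\<And>x u w. linear (\<lambda>v. \<theta> x u v w)"
      "\<And>x u v. linear (\<lambda>w. \<theta> x u v w)"
  shows "dc J 2 F x [u, v, w] = of_real (- (\<theta> x (J x u) v w + \<theta> x u (J x v) w + \<theta> x u v (J x w)
           + 3 * \<theta> x (J x u) (J x v) (J x w)) / 4)"
    and "length vs \<noteq> 3 \<Longrightarrow> dc J 2 F x vs = 0"
proof -
  note bil = bilinear_lmul[OF F_bil] bilinear_rmul[OF F_bil] bilinear_lneg[OF F_bil] bilinear_rneg[OF F_bil]
  have len2: "\<exists>v w. vs = [v, w]" if "length vs = 2" for vs :: "'a list"
    using that by (auto simp: numeral_2_eq_2 length_Suc_conv)
  have JF: "F x [J x v, w] = - F x [v, J x w]" for x v w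
    using F_J[of x "J x v" w] by (simp add: JJ bil)
  have eval: "map h [0..<2] = [h 0, h 1]" for h :: "nat \<Rightarrow> 'a \<times> 'a"
    by (simp add: numeral_2_eq_2)
  note ev = type_part_def eval part10_def part01_def
  \<comment> \<open>Invariance of F under J means type (1,1), so of the summands p = 0, 1, 2 in each
    Dolbeault operator only p = 1 survives.\<close>
  have t11: "type_part J (Suc 0) (Suc 0) (complexify F) = complexify F"
  proof (intro ext)
    fix x vs
    show "type_part J (Suc 0) (Suc 0) (complexify F) x vs = complexify F x vs"
    proof (cases "length vs = 2")
      case True
      then obtain v w where vs: "vs = [v, w]" using len2 by blast
      show ?thesis
        by (simp add: vs ev complexify_def subsets_of_card[unfolded One_nat_def] bil F_J JF JJ complex_eq_iff
            flip: numeral_2_eq_2)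
    qed (simp add: ev complexify_def F_len)
  qed
  have t20: "type_part J 2 0 (complexify F) = (\<lambda>x vs. 0)"
  proof (intro ext)
    fix x vs
    show "type_part J 2 0 (complexify F) x vs = 0"
    proof (cases "length vs = 2")
      case True
      then obtain v w where vs: "vs = [v, w]" using len2 by blast
      show ?thesis
        by (simp add: vs ev complexify_def subsets_of_card bil F_J JF JJ complex_eq_iff
            flip: numeral_2_eq_2)
    qed (simp add: ev)
  qed
  have t02: "type_part J 0 2 (complexify F) = (\<lambda>x vs. 0)"
  proof (intro ext)
    fix x vs
    show "type_part J 0 2 (complexify F) x vs = 0"
    proof (cases "length vs = 2")
      case True
      then obtain v w where vs: "vs = [v, w]" using len2 by blast
      show ?thesis
        by (simp add: vs ev complexify_def subsets_of_card bil F_J JF JJ complex_eq_iff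
            flip: numeral_2_eq_2)
    qed (simp add: ev)
  qed
  have complex_ext_0: "complex_ext (\<lambda>vs. 0) ws = 0" for ws :: "('a \<times> 'a) list"
    by (induction ws) auto
  have type_part_0: "type_part J p q (\<lambda>x vs. 0) = (\<lambda>x vs. 0)" for p q
    by (simp add: fun_eq_iff type_part_def complex_ext_0)
  have two: "{..2::nat} = {0, 1, 2}"
    by auto
  have dc: "dc J 2 F x vs = \<i> * (type_part J 1 2 (ext_deriv (complexify F)) x vs
      - type_part J 2 1 (ext_deriv (complexify F)) x vs)" for x vs
    by (simp add: dc_def delbar_def del_def two t11 t20 t02 ext_deriv_const type_part_0
        numeral_2_eq_2[symmetric])
  show "dc J 2 F x vs = 0" if "length vs \<noteq> 3" for vs
    using that by (simp add: dc type_part_def)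
  \<comment> \<open>The value r = -1/2 gives the (1,0) part and r = 1/2 the (0,1) part, so one
    formula serves all six summands of the two projections.\<close>
  have ce: "complex_ext (ext_deriv (complexify F) x)
      [((1/2) *\<^sub>R u, r1 *\<^sub>R J x u), ((1/2) *\<^sub>R v, r2 *\<^sub>R J x v), ((1/2) *\<^sub>R w, r3 *\<^sub>R J x w)] =
    Complex (\<theta> x u v w / 8 - r1 * r2 / 2 * \<theta> x (J x u) (J x v) w
        - r1 * r3 / 2 * \<theta> x (J x u) v (J x w) - r2 * r3 / 2 * \<theta> x u (J x v) (J x w))
      (r1 / 4 * \<theta> x (J x u) v w + r2 / 4 * \<theta> x u (J x v) w + r3 / 4 * \<theta> x u v (J x w)
        - r1 * r2 * r3 * \<theta> x (J x u) (J x v) (J x w))" for r1 r2 r3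
    by (simp only: complex_ext.simps dF lin[THEN linear_scale])
      (simp add: complex_eq_iff algebra_simps)
  show "dc J 2 F x [u, v, w] = of_real (- (\<theta> x (J x u) v w + \<theta> x u (J x v) w + \<theta> x u v (J x w)
           + 3 * \<theta> x (J x u) (J x v) (J x w)) / 4)"
    unfolding dc type_part_12 type_part_21 part10_def part01_def ce
    by (simp add: complex_eq_iff)
qed

section \<open>The left-invariant structures\<close>

abbreviation pt :: "E6 \<Rightarrow> real" where "pt v \<equiv> fst v"
abbreviation pu :: "E6 \<Rightarrow> real" where "pu v \<equiv> fst (snd v)"
abbreviation pz :: "E6 \<Rightarrow> complex" where "pz v \<equiv> fst (snd (snd v))"
abbreviation pw :: "E6 \<Rightarrow> complex" where "pw v \<equiv> snd (snd (snd v))"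

text \<open>In the orthonormal coframe e1 = \<open>c^(-t) du\<close>, e2 = \<open>a dt\<close> the
  (t, u) block is a quarter turn: e1 o J = e2 and e2 o J = -e1.\<close>

definition solv_J :: "real \<Rightarrow> real \<Rightarrow> E6 endo_field" where
  "solv_J a s x v = (- (exp (- (a * pt x)) * pu v) / a, a * exp (a * pt x) * pt v,
     \<i> * of_real s * pz v, \<i> * pw v)"

text \<open>The derivative of \<open>solv_J a s\<close> at \<open>x\<close> in the direction
  \<open>h\<close>, applied to \<open>v\<close>. It is free of s because the blocks on z and w are
  constant.\<close>

definition solv_dJ :: "real \<Rightarrow> E6 \<Rightarrow> E6 \<Rightarrow> E6 \<Rightarrow> E6" where
  "solv_dJ a x h v = (pt h * exp (- (a * pt x)) * pu v, a\<^sup>2 * pt h * exp (a * pt x) * pt v, 0, 0)"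

definition solv_metric :: "real \<Rightarrow> E6 metric_field" where
  "solv_metric a x v w = (exp (- (a * pt x)))\<^sup>2 * pu v * pu w + a\<^sup>2 * pt v * pt w
     + exp (a * pt x) * (pz v \<bullet> pz w) + pw v \<bullet> pw w"

text \<open>The wedge product in the determinant convention, without a factor 1/3!, as
  \<open>ext_deriv\<close> requires.\<close>

definition wedge3 :: "('a \<Rightarrow> real) \<Rightarrow> ('a \<Rightarrow> real) \<Rightarrow> ('a \<Rightarrow> real) \<Rightarrow> 'a \<Rightarrow> 'a \<Rightarrow> 'a \<Rightarrow> real" where
  "wedge3 f g h u v w = f u * (g v * h w - h v * g w) - f v * (g u * h w - h u * g w)
     + f w * (g u * h v - h u * g v)"

lemma linear_solv_J: "linear (solv_J a s x)"
  by (rule linearI) (auto simp: solv_J_def prod_eq_iff algebra_simps add_divide_distrib diff_divide_distrib complex_eq_iff)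

lemma solv_J_solv_J:
  assumes "a \<noteq> 0" "s\<^sup>2 = 1"
  shows "solv_J a s x (solv_J a s x v) = - v"
proof -
  have "\<i> * of_real s * (\<i> * of_real s * z) = - z" for z
    using assms by (simp add: complex_eq_iff power2_eq_square mult.assoc[symmetric])
  then show ?thesis
    using assms by (simp add: solv_J_def prod_eq_iff exp_minus)
qed

lemma bounded_linear_scaled_pt: "bounded_linear (\<lambda>x::E6. k * pt x)"
  by (intro bounded_linear_const_mult bounded_linear_fst)

lemma smooth_exp_pt: "smooth (\<lambda>x::E6. exp (k * pt x) *\<^sub>R v)"
  by (rule smooth_exp_linear[OF bounded_linear_scaled_pt])

lemma almost_complex_solv_J:
  assumes "a \<noteq> 0" "s\<^sup>2 = 1"
  shows "almost_complex (solv_J a s)"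
proof -
  have eq: "(\<lambda>x. solv_J a s x v) = (\<lambda>x. exp (- a * pt x) *\<^sub>R (- pu v / a, 0, 0, 0) +
      exp (a * pt x) *\<^sub>R (0, a * pt v, 0, 0) + (0, 0, \<i> * of_real s * pz v, \<i> * pw v))" for v
    by (auto simp: solv_J_def fun_eq_iff)
  show ?thesis
    by (simp only: almost_complex_def eq linear_solv_J solv_J_solv_J[OF assms] smooth_add
        smooth_exp_pt smooth_const simp_thms)
qed

lemma has_derivative_solv_J:
  assumes "(X has_derivative X') (at x)" "a \<noteq> 0"
  shows "((\<lambda>y. solv_J a s y (X y)) has_derivative
    (\<lambda>h. solv_J a s x (X' h) + solv_dJ a x h (X x))) (at x)"
  unfolding solv_J_def solv_dJ_def using assms(2)
  by (auto intro!: derivative_eq_intros assms(1) simp: fun_eq_iff power2_eq_square field_simps)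

lemma integrable_solv_J:
  assumes "a \<noteq> 0" "s\<^sup>2 = 1"
  shows "integrable_complex (solv_J a s)"
proof -
  have "nijenhuis (solv_J a s) X Y x = 0" if "smooth X" "smooth Y" for X Y x
  proof -
    define J dJ X' Y' where "J = solv_J a s x" and "dJ = solv_dJ a x"
      and "X' = frechet_derivative X (at x)" and "Y' = frechet_derivative Y (at x)"
    have X: "(X has_derivative X') (at x)" and Y: "(Y has_derivative Y') (at x)"
      using that by (simp_all add: smooth_has_derivative X'_def Y'_def)
    have JX: "frechet_derivative (\<lambda>y. solv_J a s y (X y)) (at x) = (\<lambda>h. J (X' h) + dJ h (X x))"
      and JY: "frechet_derivative (\<lambda>y. solv_J a s y (Y y)) (at x) = (\<lambda>h. J (Y' h) + dJ h (Y x))"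
      unfolding J_def dJ_def
      using has_derivative_solv_J[OF X assms(1), THEN frechet_derivative_at]
        has_derivative_solv_J[OF Y assms(1), THEN frechet_derivative_at] by simp_all
    have J: "linear J" "J (J v) = - v" for v
      using assms by (simp_all add: J_def linear_solv_J solv_J_solv_J)
    \<comment> \<open>The product rule produces terms in X' and Y', which cancel by J^2 = -1; this
      identity in the values of X and Y is all that remains. It holds because J varies only on the
      (t, u) plane, which it preserves, and in real dimension two integrability is
      automatic.\<close>
    have dJ: "dJ (J v) w - dJ (J w) v + J (dJ w v) - J (dJ v w) = 0" for v w
      using assms(1) by (simp add: J_def dJ_def solv_J_def solv_dJ_def prod_eq_iff power2_eq_square
          exp_minus field_simps)
    show ?thesis
      using dJ[of "X x" "Y x"]
      unfolding nijenhuis_def Let_def lie_bracket_def JX JY J_def[symmetric] X'_def[symmetric] Y'_def[symmetric]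
      by (simp add: J linear_add[OF J(1)] linear_diff[OF J(1)])
  qed
  then show ?thesis
    using almost_complex_solv_J[OF assms] by (simp add: integrable_complex_def)
qed

lemma riemannian_solv_metric:
  assumes "a \<noteq> 0"
  shows "riemannian_metric (solv_metric a)"
proof -
  have "bilinear (solv_metric a x)" for x
    by (auto simp: bilinear_def solv_metric_def inner_simps algebra_simps intro!: linearI)
  moreover have "solv_metric a x v v > 0" if "v \<noteq> 0" for x v
  proof -
    have "pu v \<noteq> 0 \<or> pt v \<noteq> 0 \<or> pz v \<noteq> 0 \<or> pw v \<noteq> 0"
      using that by (auto simp: prod_eq_iff)
    moreover have eq: "solv_metric a x v v = (exp (- (a * pt x)))\<^sup>2 * (pu v)\<^sup>2 + (a * pt v)\<^sup>2
        + exp (a * pt x) * (norm (pz v))\<^sup>2 + (norm (pw v))\<^sup>2"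
      by (simp add: solv_metric_def power2_norm_eq_inner power_mult_distrib)
        (simp add: power2_eq_square)
    moreover have "(exp (- (a * pt x)))\<^sup>2 * (pu v)\<^sup>2 \<ge> 0" "exp (a * pt x) * (norm (pz v))\<^sup>2 \<ge> 0"
      "(a * pt v)\<^sup>2 \<ge> 0" "(norm (pw v))\<^sup>2 \<ge> 0"
      by simp_all
    moreover have "pu v \<noteq> 0 \<Longrightarrow> (exp (- (a * pt x)))\<^sup>2 * (pu v)\<^sup>2 > 0"
      "pz v \<noteq> 0 \<Longrightarrow> exp (a * pt x) * (norm (pz v))\<^sup>2 > 0"
      "pt v \<noteq> 0 \<Longrightarrow> (a * pt v)\<^sup>2 > 0" "pw v \<noteq> 0 \<Longrightarrow> (norm (pw v))\<^sup>2 > 0"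
      using assms by simp_all
    ultimately show ?thesis by linarith
  qed
  moreover have "smooth (\<lambda>x. solv_metric a x v w)" for v w
  proof -
    have "(\<lambda>x. solv_metric a x v w) = (\<lambda>x. exp (- (2 * a) * pt x) *\<^sub>R (pu v * pu w) +
        exp (a * pt x) *\<^sub>R (pz v \<bullet> pz w) + (a\<^sup>2 * pt v * pt w + pw v \<bullet> pw w))"
      by (simp add: solv_metric_def fun_eq_iff flip: exp_double)
    then show ?thesis
      by (simp only: smooth_add smooth_exp_pt smooth_const)
  qed
  ultimately show ?thesis
    by (simp add: riemannian_metric_def solv_metric_def inner_commute mult.commute mult.left_commute)
qed

lemma hermitian_solv_J:
  assumes "a \<noteq> 0" "s\<^sup>2 = 1"
  shows "hermitian (solv_metric a) (solv_J a s)"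
proof -
  have "(\<i> * of_real s * z) \<bullet> (\<i> * of_real s * z') = z \<bullet> z'" "(\<i> * z) \<bullet> (\<i> * z') = z \<bullet> z'" for z z'
    using assms(2) by (auto simp: inner_complex_def power2_eq_1_iff)
  then show ?thesis
    using assms(1)
    by (auto simp: hermitian_def solv_metric_def solv_J_def power2_eq_square exp_minus field_simps)
qed

lemma fundamental_form_solv:
  assumes "a \<noteq> 0"
  shows "fundamental_form (solv_metric a) (solv_J a s) x [v, w] =
    exp (- (a * pt x)) * (a * (pt v * pu w - pu v * pt w)) +
    exp (a * pt x) * (s * (Re (pz v) * Im (pz w) - Im (pz v) * Re (pz w))) +
    (Re (pw v) * Im (pw w) - Im (pw v) * Re (pw w))"
  using assms by (simp add: fundamental_form_def solv_metric_def solv_J_def inner_complex_def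
      power2_eq_square exp_minus field_simps)

lemma ext_deriv_fundamental_form_solv:
  assumes "a \<noteq> 0"
  shows "ext_deriv (complexify (fundamental_form (solv_metric a) (solv_J a s))) x [u, v, w] =
    of_real (a * s * exp (a * pt x) * wedge3 pt (\<lambda>v. Re (pz v)) (\<lambda>v. Im (pz v)) u v w)"
proof -
  have "((\<lambda>y. complexify (fundamental_form (solv_metric a) (solv_J a s)) y [v, w]) has_derivative
     (\<lambda>h. of_real (- (a * pt h * exp (- (a * pt x))) * (a * (pt v * pu w - pu v * pt w)) +
       a * pt h * exp (a * pt x) * (s * (Re (pz v) * Im (pz w) - Im (pz v) * Re (pz w)))))) (at x)"
    for v w
    unfolding complexify_def fundamental_form_solv[OF assms]
    by (auto intro!: derivative_eq_intros simp: fun_eq_iff)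
  note D = frechet_derivative_at[OF this, symmetric]
  show ?thesis
    unfolding ext_deriv_three D
    by (simp add: wedge3_def algebra_simps)
qed

text \<open>Composition with J turns dt into \<open>- c^(-t) du / a\<close> and preserves dx dy, so
  the coefficient \<open>a s c^t\<close> of dF loses its dependence on t and on a.\<close>

lemma dc_fundamental_form_solv:
  assumes "a \<noteq> 0" "s\<^sup>2 = 1"
  shows "dc (solv_J a s) 2 (fundamental_form (solv_metric a) (solv_J a s)) x vs =
    (case vs of [u, v, w] \<Rightarrow> of_real (s * wedge3 pu (\<lambda>v. Re (pz v)) (\<lambda>v. Im (pz v)) u v w) | _ \<Rightarrow> 0)"
proof -
  let ?F = "fundamental_form (solv_metric a) (solv_J a s)"
  let ?\<theta> = "\<lambda>x u v w. a * s * exp (a * pt x) * wedge3 pt (\<lambda>v. Re (pz v)) (\<lambda>v. Im (pz v)) u v w"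
  have F_len: "?F x vs = 0" if "length vs \<noteq> 2" for x vs
    using that by (auto simp: fundamental_form_def split: list.split)
  have bil: "bilinear (\<lambda>v w. ?F x [v, w])" for x
    unfolding fundamental_form_solv[OF assms(1)]
    by (auto simp: bilinear_def algebra_simps intro!: linearI)
  have F_J: "?F x [solv_J a s x v, solv_J a s x w] = ?F x [v, w]" for x v w
    using hermitian_solv_J[OF assms, unfolded hermitian_def, rule_format, of x "solv_J a s x v" w]
    by (simp add: fundamental_form_def)
  have lin: "linear (\<lambda>u. ?\<theta> x u v w)" "linear (\<lambda>v. ?\<theta> x u v w)" "linear (\<lambda>w. ?\<theta> x u v w)" for x u v w
    by (auto simp: wedge3_def algebra_simps intro!: linearI)
  note hyps = bil F_J solv_J_solv_J[OF assms] ext_deriv_fundamental_form_solv[OF assms(1)] lin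
  show ?thesis
  proof (cases "length vs = 3")
    case True
    then obtain u v w where vs: "vs = [u, v, w]"
      by (auto simp: numeral_3_eq_3 length_Suc_conv)
    let ?J = "solv_J a s x"
    have dc: "dc (solv_J a s) 2 ?F x [u, v, w] =
        of_real (- (?\<theta> x (?J u) v w + ?\<theta> x u (?J v) w + ?\<theta> x u v (?J w)
          + 3 * ?\<theta> x (?J u) (?J v) (?J w)) / 4)"
      by (rule dc_two_of_type_11(1)[where \<theta> = ?\<theta>]) (erule F_len | rule hyps)+
    have s: "s = 1 \<or> s = - 1"
      using assms(2) by (simp add: power2_eq_1_iff)
    show ?thesis
      using s assms(1) unfolding vs list.case dc of_real_eq_iff
      by (auto simp: wedge3_def solv_J_def exp_minus field_simps)
  next
    case False
    then show ?thesis
      using dc_two_of_type_11(2)[where F = ?F and \<theta> = ?\<theta> and J = "solv_J a s", OF F_len hyps]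
      by (auto split: list.split)
  qed
qed

section \<open>Invariance under left translations\<close>

lemma solv_mult_eq:
  "solv_mult c \<alpha> p x = (pt p + pt x, c powr pt p * pu x + pu p, \<alpha> powr of_real (pt p) * pz x + pz p,
     exp (\<i> * (pi / 2) * pt p) * pw x + pw p)"
  by (simp add: solv_mult_def split: prod.split)

lemma has_derivative_solv_mult:
  "(solv_mult c \<alpha> p has_derivative
    (\<lambda>v. (pt v, c powr pt p * pu v, \<alpha> powr of_real (pt p) * pz v,
      exp (\<i> * (pi / 2) * pt p) * pw v))) (at x)"
proof -
  have "solv_mult c \<alpha> p = (\<lambda>x. (pt p + pt x, c powr pt p * pu x + pu p,
      \<alpha> powr of_real (pt p) * pz x + pz p, exp (\<i> * (pi / 2) * pt p) * pw x + pw p))"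
    by (simp only: fun_eq_iff solv_mult_eq) simp
  then show ?thesis
    by (auto intro!: derivative_eq_intros)
qed

lemmas frechet_derivative_solv_mult =
  frechet_derivative_at[OF has_derivative_solv_mult, symmetric]

text \<open>The relation |\<alpha>|^2 c = 1 raised to the power t. It is what balances the weight
  \<open>c^t\<close> of |dz|^2 in the metric.\<close>

lemma norm_powr_of_real_sq:
  assumes "c > 1" "(cmod \<alpha>)\<^sup>2 * c = 1"
  shows "(cmod (\<alpha> powr of_real t))\<^sup>2 = exp (- (ln c * t))"
proof -
  have "\<alpha> \<noteq> 0" using assms by auto
  then have "2 * ln (cmod \<alpha>) + ln c = ln ((cmod \<alpha>)\<^sup>2 * c)"
    using assms(1) by (simp add: ln_mult ln_realpow)
  then have "2 * ln (cmod \<alpha>) = - ln c"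
    unfolding assms(2) by simp
  then have "2 * (t * ln (cmod \<alpha>)) = - (ln c * t)"
    by (metis mult.commute mult.left_commute mult_minus_left)
  moreover have "(exp (t * ln (cmod \<alpha>)))\<^sup>2 = exp (2 * (t * ln (cmod \<alpha>)))"
    by (simp add: exp_double)
  ultimately show ?thesis
    using \<open>\<alpha> \<noteq> 0\<close> by (simp add: norm_powr_real_powr' powr_def)
qed

lemma inner_mult_complex: "(k * z) \<bullet> (k * z') = (cmod k)\<^sup>2 * (z \<bullet> z')" for k z z' :: complex
  by (simp add: inner_complex_def cmod_power2) (simp add: power2_eq_square algebra_simps)

text \<open>Translation by p shifts t and so changes the weights by powers of
  \<open>exp (a * pt p)\<close>, which the scaling of du and dz undoes. The complex factors commute
  with i, and the one on w has modulus 1.\<close>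

lemma left_invariant_solv:
  assumes "c > 1" "(cmod \<alpha>)\<^sup>2 * c = 1"
  shows "left_invariant c \<alpha> (solv_J (ln c) s) (solv_J (ln c) s') (solv_metric (ln c))"
proof -
  have powr: "c powr t = exp (ln c * t)" for t
    using assms(1) by (simp add: powr_def mult.commute)
  have J: "invariant_endo (left_translations c \<alpha> UNIV) (solv_J (ln c) s)" for s
    unfolding invariant_endo_def left_translations_def
    by (auto simp: frechet_derivative_solv_mult solv_J_def solv_mult_eq powr exp_add exp_minus
        algebra_simps simp del: split_paired_All)
  have n: "(cmod (exp (\<i> * (pi / 2) * of_real t)))\<^sup>2 = 1" for t
    by simp
  have "invariant_metric (left_translations c \<alpha> UNIV) (solv_metric (ln c))"
    unfolding invariant_metric_def left_translations_def ball_simps frechet_derivative_solv_mult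
      solv_metric_def solv_mult_eq fst_conv snd_conv inner_mult_complex norm_powr_of_real_sq[OF assms] n
    by (simp add: powr distrib_left exp_add exp_minus exp_diff power2_eq_square inverse_eq_divide del: split_paired_All)
  with J show ?thesis
    by (simp add: left_invariant_def Let_def)
qed

section \<open>The lattice\<close>

text \<open>The witness is the adjugate. Its entries stay in the ring, so the inverse of the integer
  matrix is again an integer matrix.\<close>

lemma int_matrix_left_inverse_3:
  fixes m :: "'a::comm_ring_1^3^3"
  assumes "det m = 1"
  obtains N where "N ** m = mat 1"
proof
  let ?N = "vector
   [vector [m$2$2 * m$3$3 - m$2$3 * m$3$2, m$1$3 * m$3$2 - m$1$2 * m$3$3, m$1$2 * m$2$3 - m$1$3 * m$2$2],
    vector [m$2$3 * m$3$1 - m$2$1 * m$3$3, m$1$1 * m$3$3 - m$1$3 * m$3$1, m$1$3 * m$2$1 - m$1$1 * m$2$3],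
    vector [m$2$1 * m$3$2 - m$2$2 * m$3$1, m$1$2 * m$3$1 - m$1$1 * m$3$2, m$1$1 * m$2$2 - m$1$2 * m$2$1]]
    :: 'a^3^3"
  show "?N ** m = mat 1"
    using assms unfolding det_3
    by (simp add: vec_eq_iff forall_3 matrix_matrix_mult_def sum_3 mat_def algebra_simps)
qed

text \<open>Scaling an integer combination of the entries by the eigenvalue only moves its
  coefficient row by m, so the result is again an integer combination. Hence the group generated by
  these entries is stable under g_0.\<close>

lemma eigenvector_row_action:
  fixes m :: "int^'n^'n" and e :: "'a::comm_ring_1^'n"
  assumes "\<And>j. l * e $ j = (\<Sum>k\<in>UNIV. of_int (m $ j $ k) * e $ k)"
  shows "l * (\<Sum>j\<in>UNIV. of_int (k $ j) * e $ j) = (\<Sum>j\<in>UNIV. of_int ((k v* m) $ j) * e $ j)"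
proof -
  have "l * (\<Sum>j\<in>UNIV. of_int (k $ j) * e $ j) = (\<Sum>j\<in>UNIV. of_int (k $ j) * (l * e $ j))"
    by (simp add: sum_distrib_left mult.left_commute)
  also have "\<dots> = (\<Sum>i\<in>UNIV. \<Sum>j\<in>UNIV. of_int (k $ j) * of_int (m $ j $ i) * e $ i)"
    unfolding assms sum_distrib_left by (subst sum.swap) (simp add: mult.assoc)
  finally show ?thesis
    by (simp add: vector_matrix_mult_def sum_distrib_right)
qed

lemma powr_of_int_add_diff_one:
  assumes "x \<noteq> 0"
  shows "(x::complex) powr of_int (n + 1) = x * x powr of_int n"
    "x powr of_int (n - 1) = inverse x * x powr of_int n"
  using assms by (simp_all add: powr_add powr_diff field_simps)

lemma exp_quarter_turn_add_diff_one:
  "exp (\<i> * (pi / 2) * of_int (n + 1)) = \<i> * exp (\<i> * (pi / 2) * of_int n)"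
  "exp (\<i> * (pi / 2) * of_int (n - 1)) = - \<i> * exp (\<i> * (pi / 2) * of_int n)"
proof -
  have "exp (\<i> * of_real (pi / 2)) = \<i>"
    using cis_pi_half unfolding cis_conv_exp .
  then have e: "exp (\<i> * of_real pi / 2) = \<i>"
    by simp
  show "exp (\<i> * (pi / 2) * of_int (n + 1)) = \<i> * exp (\<i> * (pi / 2) * of_int n)"
    by (simp add: distrib_left exp_add e)
  show "exp (\<i> * (pi / 2) * of_int (n - 1)) = - \<i> * exp (\<i> * (pi / 2) * of_int n)"
    by (simp add: right_diff_distrib exp_diff e)
qed

locale solv_lattice_data =
  fixes m :: "int^3^3" and c :: real and \<alpha> :: complex and cv :: "real^3" and \<alpha>v :: "complex^3"
  assumes det_m: "det m = 1"
    and nonreal: "\<alpha> \<notin> \<real>"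
    and c_gt_1: "c > 1"
    and norm_\<alpha>: "(cmod \<alpha>)\<^sup>2 * c = 1"
    and \<alpha>v_nz: "\<alpha>v \<noteq> 0" and \<alpha>v: "\<And>j. \<alpha> * \<alpha>v $ j = (\<Sum>k\<in>UNIV. of_int (m $ j $ k) * \<alpha>v $ k)"
    and cv_nz: "cv \<noteq> 0" and cv: "\<And>j. c * cv $ j = (\<Sum>k\<in>UNIV. of_int (m $ j $ k) * cv $ k)"
begin

abbreviation "G \<equiv> solv_group c \<alpha>"
abbreviation "\<Gamma> \<equiv> solv_lattice c \<alpha> cv \<alpha>v"

definition basis_matrix :: "real^3^3" where
  "basis_matrix = vector [vector [cv $ 1, Re (\<alpha>v $ 1), Im (\<alpha>v $ 1)],
     vector [cv $ 2, Re (\<alpha>v $ 2), Im (\<alpha>v $ 2)], vector [cv $ 3, Re (\<alpha>v $ 3), Im (\<alpha>v $ 3)]]"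

definition comb :: "real^3 \<Rightarrow> real \<times> complex" where
  "comb r = (\<Sum>j\<in>UNIV. r $ j * cv $ j, \<Sum>j\<in>UNIV. of_real (r $ j) * \<alpha>v $ j)"

abbreviation of_int_vec :: "int^3 \<Rightarrow> real^3" where
  "of_int_vec k \<equiv> (\<chi> j. of_int (k $ j))"

definition int_combs :: "(real \<times> complex) set" where
  "int_combs = range (\<lambda>k. comb (of_int_vec k))"

definition gauss_ints :: "complex set" where
  "gauss_ints = {of_int a + \<i> * of_int b |a b. True}"

text \<open>The semidirect product of Z with Z^3 x Z^2 as an explicit set. It is a subgroup that
  contains the generators, and so bounds \<open>\<Gamma>\<close> from outside.\<close>

definition lattice_points :: "E6 set" where
  "lattice_points = {(of_int n, u, z, w) |n u z w. (u, z) \<in> int_combs \<and> w \<in> gauss_ints}"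

section \<open>Linear independence of the vectors (c_j, \<alpha>_j)\<close>

lemma \<alpha>_nz: "\<alpha> \<noteq> 0"
  using nonreal by auto

lemma group_G: "group G"
  using c_gt_1 \<alpha>_nz by (simp add: group_solv_group)

text \<open>A relation x cv + Re (\<beta> \<alpha>v) = 0 persists when the matrix is applied to it; three such
  relations separate the eigenvalues.\<close>

lemma eigenvectors_independent:
  assumes rel: "\<And>j. x * cv $ j + Re (\<beta> * \<alpha>v $ j) = 0"
  shows "x = 0 \<and> \<beta> = 0"
proof -
  have step: "x * c * cv $ j + Re (\<beta> * \<alpha> * \<alpha>v $ j) = 0"
    if "\<And>j. x * cv $ j + Re (\<beta> * \<alpha>v $ j) = 0" for x \<beta> j
  proof -
    have "x * c * cv $ j + Re (\<beta> * \<alpha> * \<alpha>v $ j) = x * (c * cv $ j) + Re (\<beta> * (\<alpha> * \<alpha>v $ j))"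
      by (simp only: mult.assoc)
    also have "\<dots> = (\<Sum>k\<in>UNIV. of_int (m $ j $ k) * (x * cv $ k + Re (\<beta> * \<alpha>v $ k)))"
      unfolding \<alpha>v cv by (simp add: sum_3 algebra_simps)
    finally show ?thesis using that by simp
  qed
  note rel2 = step[OF rel]
  note rel3 = step[OF rel2]
  have Im_\<alpha>: "Im \<alpha> \<noteq> 0"
    using nonreal complex_is_Real_iff by blast
  have "x * cv $ j = 0 \<and> \<beta> * \<alpha>v $ j = 0" for j
  proof -
    define p q where "p = x * cv $ j" and "q = \<beta> * \<alpha>v $ j"
    have 1: "p + Re q = 0" and 2: "c * p + Re (\<alpha> * q) = 0" and 3: "c * (c * p) + Re (\<alpha> * (\<alpha> * q)) = 0"
      using rel[of j] rel2[of j] rel3[of j] by (simp_all add: p_def q_def ac_simps del: times_complex.sel)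
    \<comment> \<open>The real minimal polynomial T^2 - 2 Re(\<alpha>) T + |\<alpha>|^2 of \<alpha>,
      applied to the three relations, removes q and leaves its value at c, namely |c - \<alpha>|^2,
      times p.\<close>
    have "((c - Re \<alpha>)\<^sup>2 + (Im \<alpha>)\<^sup>2) * p = 0"
      using 1 2[unfolded times_complex.sel] 3[unfolded times_complex.sel] by algebra
    moreover have "(c - Re \<alpha>)\<^sup>2 + (Im \<alpha>)\<^sup>2 > 0"
      using Im_\<alpha> by (simp add: add_nonneg_pos)
    ultimately have p: "p = 0"
      by (metis mult_eq_0_iff less_irrefl)
    then have "Re q = 0" "Im q = 0"
      using 1 2 Im_\<alpha> by simp_all
    then show ?thesis
      using p by (simp add: p_def q_def complex_eq_iff)
  qed
  then show ?thesis
    using cv_nz \<alpha>v_nz by (auto simp: vec_eq_iff)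
qed

lemma det_basis_matrix: "det basis_matrix \<noteq> 0"
proof -
  have "x = 0" if "basis_matrix *v x = 0" for x
  proof -
    \<comment> \<open>Since Re((x2 - i x3) z) = x2 Re z + x3 Im z, a kernel vector is a relation of
      the kind just excluded.\<close>
    have "x $ 1 * cv $ j + Re (Complex (x $ 2) (- x $ 3) * \<alpha>v $ j) = 0" for j
      using that exhaust_3[of j]
      by (auto simp: vec_eq_iff forall_3 matrix_vector_mult_def basis_matrix_def sum_3 algebra_simps)
    from eigenvectors_independent[OF this] show ?thesis
      by (simp add: vec_eq_iff forall_3 complex_eq_iff)
  qed
  then show ?thesis
    using matrix_left_invertible_ker[of basis_matrix] invertible_left_inverse[of basis_matrix]
      invertible_det_nz[of basis_matrix] by blast
qed

lemma comb_eq: "comb r = (let y = r v* basis_matrix in (y $ 1, Complex (y $ 2) (y $ 3)))"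
  by (simp add: comb_def basis_matrix_def vector_matrix_mult_def sum_3 complex_eq_iff Let_def)

lemma linear_comb: "linear comb"
  by (rule linearI) (auto simp: comb_def sum_3 algebra_simps scaleR_conv_of_real[where 'a = complex])

lemma inj_comb: "inj comb"
proof -
  obtain B where B: "basis_matrix ** B = mat 1"
    using det_basis_matrix invertible_det_nz invertible_right_inverse by blast
  have "r = 0" if "comb r = 0" for r
  proof -
    have "r v* basis_matrix = 0"
      using that by (simp add: comb_eq Let_def vec_eq_iff forall_3 prod_eq_iff complex_eq_iff)
    then have "r v* (basis_matrix ** B) = 0"
      by (simp flip: vector_matrix_mul_assoc)
    then show ?thesis by (simp add: B)
  qed
  then show ?thesis
    using linear_injective_0[OF linear_comb] by blast
qed

lemma surj_comb: "\<exists>r. comb r = y"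
proof -
  obtain B where B: "B ** basis_matrix = mat 1"
    using det_basis_matrix invertible_det_nz invertible_left_inverse by blast
  define y' :: "real^3" where "y' = vector [fst y, Re (snd y), Im (snd y)]"
  have "(y' v* B) v* basis_matrix = y'"
    by (simp add: vector_matrix_mul_assoc B)
  then have "comb (y' v* B) = y"
    by (simp add: comb_eq Let_def y'_def prod_eq_iff complex_eq_iff)
  then show ?thesis ..
qed

section \<open>The explicit lattice as a subgroup\<close>

lemma int_combs_closed:
  assumes "p \<in> int_combs" "q \<in> int_combs"
  shows "p + q \<in> int_combs" "- p \<in> int_combs"
proof -
  obtain k l where p: "p = comb (of_int_vec k)" and q: "q = comb (of_int_vec l)"
    using assms by (auto simp: int_combs_def)
  have "of_int_vec (k + l) = of_int_vec k + of_int_vec l" "of_int_vec (- k) = - of_int_vec k"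
    by (simp_all add: vec_eq_iff)
  then have "p + q = comb (of_int_vec (k + l))" "- p = comb (of_int_vec (- k))"
    by (simp_all only: p q linear_add[OF linear_comb] linear_neg[OF linear_comb])
  then show "p + q \<in> int_combs" "- p \<in> int_combs"
    unfolding int_combs_def by blast+
qed

lemma zero_int_combs: "(0, 0) \<in> int_combs"
  by (auto simp: int_combs_def comb_def sum_3 intro!: exI[of _ 0] range_eqI[of _ _ 0])

text \<open>The pair (c, \<alpha>) acts on integer coordinates through m, and its inverse through
  the inverse of m, which is integral because det m = 1.\<close>

lemma int_combs_mult:
  assumes "(u, z) \<in> int_combs"
  shows "(c * u, \<alpha> * z) \<in> int_combs" "(inverse c * u, inverse \<alpha> * z) \<in> int_combs"
proof -
  obtain k where k: "(u, z) = comb (of_int_vec k)"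
    using assms by (auto simp: int_combs_def)
  have mult: "(c * fst (comb (of_int_vec k)), \<alpha> * snd (comb (of_int_vec k))) = comb (of_int_vec (k v* m))" for k
    using eigenvector_row_action[OF cv] eigenvector_row_action[OF \<alpha>v] by (simp add: comb_def)
  then show "(c * u, \<alpha> * z) \<in> int_combs"
    using mult[of k] by (auto simp: int_combs_def simp flip: k)
  obtain N where N: "N ** m = mat 1"
    using int_matrix_left_inverse_3[OF det_m] by blast
  then have "(k v* N) v* m = k"
    by (simp add: vector_matrix_mul_assoc)
  then have "c * fst (comb (of_int_vec (k v* N))) = u" "\<alpha> * snd (comb (of_int_vec (k v* N))) = z"
    using mult[of "k v* N"] k by (auto simp: prod_eq_iff)
  then have "comb (of_int_vec (k v* N)) = (inverse c * u, inverse \<alpha> * z)"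
    using c_gt_1 \<alpha>_nz by (auto simp: prod_eq_iff)
  then show "(inverse c * u, inverse \<alpha> * z) \<in> int_combs"
    by (metis int_combs_def rangeI)
qed

lemma int_combs_powr:
  assumes "(u, z) \<in> int_combs"
  shows "(c powr of_int n * u, \<alpha> powr of_int n * z) \<in> int_combs"
proof (induction n rule: int_induct[of _ 0])
  case base
  then show ?case using assms c_gt_1 \<alpha>_nz by simp
next
  case (step1 i)
  then show ?case
    using int_combs_mult(1)[OF step1(2)] powr_of_int_add_diff_one(1)[OF \<alpha>_nz, of i] c_gt_1
    by (simp add: powr_add mult.assoc mult.left_commute mult.commute)
next
  case (step2 i)
  then show ?case
    using int_combs_mult(2)[OF step2(2)] powr_of_int_add_diff_one(2)[OF \<alpha>_nz, of i] c_gt_1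
    by (simp add: powr_diff divide_inverse mult.assoc mult.left_commute mult.commute)
qed

lemma lattice_pointsE:
  assumes "p \<in> lattice_points"
  obtains n k a b where "p = (of_int n, fst (comb (of_int_vec k)), snd (comb (of_int_vec k)),
    of_int a + \<i> * of_int b)"
proof -
  obtain n u z w where p: "p = (of_int n, u, z, w)" "(u, z) \<in> int_combs" "w \<in> gauss_ints"
    using assms by (auto simp: lattice_points_def)
  moreover obtain k where "(u, z) = comb (of_int_vec k)"
    using p(2) by (auto simp: int_combs_def)
  then have "u = fst (comb (of_int_vec k))" "z = snd (comb (of_int_vec k))"
    by (metis fst_conv, metis snd_conv)
  moreover obtain a b where "w = of_int a + \<i> * of_int b"
    using p(3) by (auto simp: gauss_ints_def)
  ultimately show ?thesis
    by (intro that) simp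
qed

lemma gauss_intsI: "of_int a + \<i> * of_int b \<in> gauss_ints"
  by (auto simp: gauss_ints_def)

lemma gauss_ints_closed:
  assumes "w \<in> gauss_ints" "w' \<in> gauss_ints"
  shows "w + w' \<in> gauss_ints" "- w \<in> gauss_ints" "\<i> * w \<in> gauss_ints"
proof -
  obtain a b a' b' where "w = of_int a + \<i> * of_int b" "w' = of_int a' + \<i> * of_int b'"
    using assms by (auto simp: gauss_ints_def)
  then show "w + w' \<in> gauss_ints" "- w \<in> gauss_ints" "\<i> * w \<in> gauss_ints"
    using gauss_intsI[of "a + a'" "b + b'"] gauss_intsI[of "- a" "- b"] gauss_intsI[of "- b" a]
    by (simp_all add: algebra_simps)
qed

text \<open>At integer times the rotation is a power of i, which preserves the Gaussian integers;
  the angle pi/2 enters here.\<close>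

lemma gauss_ints_rotate:
  assumes "w \<in> gauss_ints"
  shows "exp (\<i> * (pi / 2) * of_int n) * w \<in> gauss_ints"
proof (induction n rule: int_induct[of _ 0])
  case base
  then show ?case using assms by simp
next
  case (step1 i)
  then show ?case
    unfolding exp_quarter_turn_add_diff_one using gauss_ints_closed(3)[OF step1(2,2)]
    by (simp only: mult.assoc)
next
  case (step2 i)
  then show ?case
    unfolding exp_quarter_turn_add_diff_one
    using gauss_ints_closed(2)[OF gauss_ints_closed(3)[OF step2(2,2)], OF step2(2)]
    by (simp only: mult.assoc mult_minus_left)
qed

lemma inv_G: "inv\<^bsub>G\<^esub> (t, u, z, w) = (- t, - (c powr (- t) * u), - (\<alpha> powr of_real (- t) * z),
    - (exp (\<i> * (pi / 2) * of_real (- t)) * w))"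
  by (rule group.inv_equality[OF group_G]) (simp_all add: solv_group_def solv_mult_eq)

text \<open>Products and inverses twist the fibre coordinates by c^n, \<alpha>^n and i^n with n an
  integer, and these preserve \<open>int_combs\<close> and \<open>gauss_ints\<close>.\<close>

lemma subgroup_lattice_points: "subgroup lattice_points G"
proof (rule group.subgroupI[OF group_G])
  show "lattice_points \<subseteq> carrier G"
    by (simp add: solv_group_def)
  have "0 \<in> gauss_ints"
    using gauss_intsI[of 0 0] by simp
  with zero_int_combs show "lattice_points \<noteq> {}"
    by (auto simp: lattice_points_def)
next
  fix a assume "a \<in> lattice_points"
  then obtain n u z w where a: "a = (of_int n, u, z, w)" and uz: "(u, z) \<in> int_combs" and w: "w \<in> gauss_ints"
    by (auto simp: lattice_points_def)
  have "- (c powr of_int (- n) * u, \<alpha> powr of_int (- n) * z) \<in> int_combs"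
    using int_combs_closed(2) int_combs_powr[OF uz] by blast
  moreover have "- (exp (\<i> * (pi / 2) * of_int (- n)) * w) \<in> gauss_ints"
    using gauss_ints_closed(2) gauss_ints_rotate[OF w] by blast
  ultimately show "inv\<^bsub>G\<^esub> a \<in> lattice_points"
    by (auto simp: a inv_G lattice_points_def intro!: exI[of _ "- n"])
next
  fix a b assume "a \<in> lattice_points" "b \<in> lattice_points"
  then obtain n u z w n' u' z' w' where a: "a = (of_int n, u, z, w)" "(u, z) \<in> int_combs" "w \<in> gauss_ints"
    and b: "b = (of_int n', u', z', w')" "(u', z') \<in> int_combs" "w' \<in> gauss_ints"
    by (auto simp: lattice_points_def)
  have "(c powr of_int n * u', \<alpha> powr of_int n * z') + (u, z) \<in> int_combs"
    by (intro int_combs_closed int_combs_powr a b)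
  moreover have "exp (\<i> * (pi / 2) * of_int n) * w' + w \<in> gauss_ints"
    by (intro gauss_ints_closed gauss_ints_rotate a b)
  ultimately show "a \<otimes>\<^bsub>G\<^esub> b \<in> lattice_points"
    by (auto simp: a b solv_group_def solv_mult_eq lattice_points_def intro!: exI[of _ "n + n'"])
qed

lemma generators_in_lattice_points: "lattice_generators cv \<alpha>v \<subseteq> lattice_points"
proof -
  have g: "0 \<in> gauss_ints" "1 \<in> gauss_ints" "\<i> \<in> gauss_ints"
    using gauss_intsI[of 0 0] gauss_intsI[of 1 0] gauss_intsI[of 0 1] by simp_all
  have "comb (of_int_vec (axis j 1)) = (cv $ j, \<alpha>v $ j)" for j
    using exhaust_3[of j] by (auto simp: comb_def sum_3 axis_def)
  then have "(cv $ j, \<alpha>v $ j) \<in> int_combs" for j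
    by (metis int_combs_def rangeI)
  with g zero_int_combs show ?thesis
    by (auto simp: lattice_generators_def lattice_points_def intro: exI[of _ 0] exI[of _ 1])
qed

lemma \<Gamma>_subset: "\<Gamma> \<subseteq> lattice_points"
  unfolding solv_lattice_def
  by (rule group.generate_subgroup_incl[OF group_G generators_in_lattice_points subgroup_lattice_points])

lemma subgroup_\<Gamma>: "subgroup \<Gamma> G"
  unfolding solv_lattice_def
  by (rule group.generate_is_subgroup[OF group_G]) (simp add: solv_group_def)

lemma \<Gamma>_mult: "p \<in> \<Gamma> \<Longrightarrow> q \<in> \<Gamma> \<Longrightarrow> solv_mult c \<alpha> p q \<in> \<Gamma>"
  using subgroup.m_closed[OF subgroup_\<Gamma>] by (simp add: solv_group_def)

lemma \<Gamma>_generator: "g \<in> lattice_generators cv \<alpha>v \<Longrightarrow> g \<in> \<Gamma>"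
  unfolding solv_lattice_def by (rule generate.incl)

lemma \<Gamma>_inv: "p \<in> \<Gamma> \<Longrightarrow> inv\<^bsub>G\<^esub> p \<in> \<Gamma>"
  by (rule subgroup.m_inv_closed[OF subgroup_\<Gamma>])

lemma \<Gamma>_shift: "(of_int n, 0, 0, 0) \<in> \<Gamma>"
proof (induction n rule: int_induct[of _ 0])
  case base
  then show ?case using subgroup.one_closed[OF subgroup_\<Gamma>] by (simp add: solv_group_def)
next
  have g: "(1, 0, 0, 0) \<in> \<Gamma>"
    by (rule \<Gamma>_generator) (simp add: lattice_generators_def)
  {
    case (step1 i)
    then show ?case using \<Gamma>_mult[OF step1(2) g] by (simp add: solv_mult_eq)
  next
    case (step2 i)
    then show ?case using \<Gamma>_mult[OF step2(2) \<Gamma>_inv[OF g]] by (simp add: solv_mult_eq inv_G)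
  }
qed

text \<open>At t = 0 every twisting factor is 1, so the group law there is vector addition.\<close>

lemma \<Gamma>_add:
  assumes "(0, x) \<in> \<Gamma>" "(0, y) \<in> \<Gamma>"
  shows "(0, x + y) \<in> \<Gamma>"
  using \<Gamma>_mult[OF assms] c_gt_1 \<alpha>_nz by (cases x; cases y) (simp add: solv_mult_eq add.commute)

lemma \<Gamma>_scale:
  assumes "(0, x) \<in> \<Gamma>"
  shows "(0, of_int n *\<^sub>R x) \<in> \<Gamma>"
proof (induction n rule: int_induct[of _ 0])
  case base
  then show ?case
    using subgroup.one_closed[OF subgroup_\<Gamma>] by (simp add: solv_group_def zero_prod_def)
next
  case (step1 i)
  then show ?case
    using \<Gamma>_add[OF step1(2) assms] by (simp add: scaleR_left_distrib)
next
  case (step2 i)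
  have neg: "(0, - x) \<in> \<Gamma>"
    using \<Gamma>_inv[OF assms] c_gt_1 \<alpha>_nz by (cases x) (simp add: inv_G)
  show ?case
    using \<Gamma>_add[OF step2(2) neg] by (simp add: scaleR_left_diff_distrib)
qed

text \<open>Supplies the translations that bring a point into the fundamental domain.\<close>

lemma \<Gamma>_translation:
  "(0, fst (comb (of_int_vec k)), snd (comb (of_int_vec k)), of_int a + \<i> * of_int b) \<in> \<Gamma>"
proof -
  have g: "(0, cv $ j, \<alpha>v $ j, 0) \<in> \<Gamma>" "(0, 0, 0, 1) \<in> \<Gamma>" "(0, 0, 0, \<i>) \<in> \<Gamma>" for j
    by (rule \<Gamma>_generator, simp add: lattice_generators_def)+
  let ?v = "\<lambda>j. of_int (k $ j) *\<^sub>R (cv $ j, \<alpha>v $ j, 0::complex)"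
  have "(0, ?v 1 + ?v 2 + ?v 3 + of_int a *\<^sub>R (0, 0, 1) + of_int b *\<^sub>R (0, 0, \<i>)) \<in> \<Gamma>"
    by (intro \<Gamma>_add \<Gamma>_scale g)
  moreover have "?v 1 + ?v 2 + ?v 3 + of_int a *\<^sub>R (0, 0, 1) + of_int b *\<^sub>R (0, 0, \<i>) =
    (fst (comb (of_int_vec k)), snd (comb (of_int_vec k)), of_int a + \<i> * of_int b)"
    by (simp add: comb_def sum_3 scaleR_conv_of_real)
  ultimately show ?thesis by simp
qed

text \<open>Integers closer than 1 are equal. For the coordinates (u, z) this applies after pulling
  back along \<open>comb\<close>, which is bounded below by some B because it is linear and
  injective; the points are therefore separated uniformly, by min 1 B.\<close>

lemma discrete_\<Gamma>: "discrete \<Gamma>"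
proof -
  obtain B where B: "B > 0" "\<And>x. B * norm x \<le> norm (comb x)"
    using linear_inj_bounded_below_pos[OF linear_comb inj_comb] by blast
  have int_eq: "i = j" if "\<bar>real_of_int i - real_of_int j\<bar> < 1" for i j :: int
    using that by linarith
  have "p = q" if "p \<in> \<Gamma>" "q \<in> \<Gamma>" and d: "dist p q < min 1 B" for p q
  proof -
    obtain n k a b where p: "p = (of_int n, fst (comb (of_int_vec k)), snd (comb (of_int_vec k)),
        of_int a + \<i> * of_int b)"
      using \<open>p \<in> \<Gamma>\<close> \<Gamma>_subset lattice_pointsE by blast
    obtain n' k' a' b' where q: "q = (of_int n', fst (comb (of_int_vec k')), snd (comb (of_int_vec k')),
        of_int a' + \<i> * of_int b')"
      using \<open>q \<in> \<Gamma>\<close> \<Gamma>_subset lattice_pointsE by blast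
    have "dist (pt p) (pt q) \<le> dist p q"
      by (rule dist_fst_le)
    then have n: "n = n'"
      using d by (intro int_eq) (simp add: dist_real_def p q)
    have "norm (comb (of_int_vec k) - comb (of_int_vec k')) \<le> norm (p - q)"
      by (simp add: p q norm_prod_def)
    then have "norm (comb (of_int_vec k - of_int_vec k')) < B"
      using d by (simp add: dist_norm linear_diff[OF linear_comb])
    then have "B * norm (of_int_vec k - of_int_vec k') < B * 1"
      using B(2)[of "of_int_vec k - of_int_vec k'"] by simp
    then have "norm (of_int_vec k - of_int_vec k') < 1"
      using B(1) by (simp only: mult_less_cancel_left_pos)
    then have "\<bar>(of_int_vec k - of_int_vec k') $ j\<bar> < 1" for j
      using component_le_norm_cart[of "of_int_vec k - of_int_vec k'" j] by linarith
    then have k: "k = k'"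
      using int_eq by (simp add: vec_eq_iff)
    have "dist (pw p) (pw q) \<le> dist p q"
      by (meson dist_snd_le order_trans)
    then have "norm (pw p - pw q) < 1"
      using d by (simp add: dist_norm)
    then have "\<bar>real_of_int a - real_of_int a'\<bar> < 1" "\<bar>real_of_int b - real_of_int b'\<bar> < 1"
      using abs_Re_le_cmod[of "pw p - pw q"] abs_Im_le_cmod[of "pw p - pw q"] by (simp_all add: p q)
    then have "a = a'" "b = b'"
      using int_eq by blast+
    then show ?thesis using n k p q by simp
  qed
  then have "uniform_discrete \<Gamma>"
    unfolding uniform_discrete_def using B(1) by (intro exI[of _ "min 1 B"]) auto
  then show ?thesis by (rule uniform_discrete_imp_discrete)
qed

section \<open>Compactness of the orbit space\<close>

definition fund_domain :: "E6 set" where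
  "fund_domain = (\<lambda>(t, r, w). (t, fst (comb r), snd (comb r), w)) ` ({0..1} \<times> cbox 0 1 \<times> cbox 0 (1 + \<i>))"

lemma compact_fund_domain: "compact fund_domain"
  unfolding fund_domain_def
proof (rule compact_continuous_image)
  show "continuous_on ({0..1} \<times> cbox 0 1 \<times> cbox 0 (1 + \<i>)) (\<lambda>(t, r, w). (t, fst (comb r), snd (comb r), w))"
    by (auto simp: comb_def case_prod_unfold intro!: continuous_intros)
  show "compact ({0..1::real} \<times> cbox (0::real^3) 1 \<times> cbox 0 (1 + \<i>))"
    by (intro compact_Times compact_cbox compact_Icc)
qed

text \<open>The domain has closed faces and an orbit may meet it more than once; for compactness it
  is enough that every orbit meets it.\<close>

lemma fund_domain_meets_orbits: "\<exists>\<gamma>\<in>\<Gamma>. solv_mult c \<alpha> \<gamma> x \<in> fund_domain"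
proof -
  \<comment> \<open>The shift in t has to come first, because it twists the other coordinates; the
    translations computed from x' then leave t alone.\<close>
  define n where "n = - \<lfloor>pt x\<rfloor>"
  define x' where "x' = solv_mult c \<alpha> (of_int n, 0, 0, 0) x"
  obtain r where r: "comb r = (pu x', pz x')"
    using surj_comb by blast
  define k where "k = (\<chi> j. - \<lfloor>r $ j\<rfloor>)"
  define a b where "a = - \<lfloor>Re (pw x')\<rfloor>" and "b = - \<lfloor>Im (pw x')\<rfloor>"
  define \<gamma> where "\<gamma> = (0::real, fst (comb (of_int_vec k)), snd (comb (of_int_vec k)),
    of_int a + \<i> * of_int b)"
  have "\<gamma> \<in> \<Gamma>"
    unfolding \<gamma>_def by (rule \<Gamma>_translation)
  then have "solv_mult c \<alpha> \<gamma> (of_int n, 0, 0, 0) \<in> \<Gamma>"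
    by (rule \<Gamma>_mult[OF _ \<Gamma>_shift])
  moreover have "solv_mult c \<alpha> (solv_mult c \<alpha> \<gamma> (of_int n, 0, 0, 0)) x = solv_mult c \<alpha> \<gamma> x'"
    using group.is_monoid[OF group_G, THEN monoid.m_assoc, of \<gamma> "(of_int n, 0, 0, 0)" x]
    by (simp add: solv_group_def x'_def)
  moreover have "solv_mult c \<alpha> \<gamma> x' \<in> fund_domain"
  proof -
    have "solv_mult c \<alpha> \<gamma> x' = (\<lambda>(t, r, w). (t, fst (comb r), snd (comb r), w))
        (pt x', r + of_int_vec k, pw x' + (of_int a + \<i> * of_int b))"
      using r c_gt_1 \<alpha>_nz by (simp add: solv_mult_eq \<gamma>_def linear_add[OF linear_comb] prod_eq_iff)
    moreover have "pt x' \<in> {0..1}"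
      by (simp add: x'_def solv_mult_eq n_def) linarith
    moreover have "r + of_int_vec k \<in> cbox 0 1"
      by (simp add: mem_box_cart k_def) linarith
    moreover have "pw x' + (of_int a + \<i> * of_int b) \<in> cbox 0 (1 + \<i>)"
      by (simp add: in_cbox_complex_iff a_def b_def) linarith
    ultimately show ?thesis
      unfolding fund_domain_def by blast
  qed
  ultimately show ?thesis by metis
qed

lemma compact_orbit_space: "compact_space (orbit_space c \<alpha> \<Gamma>)"
proof -
  let ?R = "rcosets\<^bsub>G\<^esub> \<Gamma>"
  \<comment> \<open>Cosets that share a point are equal. This makes union commute with intersection,
    so that the saturated open sets form a topology, and it lets a coset be recognized in the finite
    subcover by the one point where it meets the fundamental domain.\<close>
  have disj: "C = C'" if "C \<in> ?R" "C' \<in> ?R" "x \<in> C" "x \<in> C'" for C C' x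
    using group.rcos_disjoint[OF group_G subgroup_\<Gamma>] that
    by (auto simp: pairwise_def disjnt_def)
  have "istopology (\<lambda>U. U \<subseteq> ?R \<and> open (\<Union>U))"
    unfolding istopology_def
  proof (intro conjI allI impI)
    fix U V assume U: "U \<subseteq> ?R \<and> open (\<Union>U)" and V: "V \<subseteq> ?R \<and> open (\<Union>V)"
    then have "\<Union>(U \<inter> V) = \<Union>U \<inter> \<Union>V"
      using disj by blast
    then show "U \<inter> V \<subseteq> ?R" "open (\<Union>(U \<inter> V))"
      using U V by auto
  next
    fix \<K> assume "\<forall>K\<in>\<K>. K \<subseteq> ?R \<and> open (\<Union>K)"
    moreover have "\<Union>(\<Union>\<K>) = (\<Union>K\<in>\<K>. \<Union>K)" by blast
    ultimately show "\<Union>\<K> \<subseteq> ?R" "open (\<Union>(\<Union>\<K>))"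
      by auto
  qed
  then have openin: "openin (orbit_space c \<alpha> \<Gamma>) U \<longleftrightarrow> U \<subseteq> ?R \<and> open (\<Union>U)" for U
    by (simp add: orbit_space_def)
  have union: "\<Union>?R = UNIV"
    using group.rcosets_part_G[OF group_G subgroup_\<Gamma>] by (simp add: solv_group_def)
  have space: "topspace (orbit_space c \<alpha> \<Gamma>) = ?R"
  proof
    show "?R \<subseteq> topspace (orbit_space c \<alpha> \<Gamma>)"
      by (rule openin_subset) (simp add: openin union)
    show "topspace (orbit_space c \<alpha> \<Gamma>) \<subseteq> ?R"
      using openin_topspace openin by blast
  qed
  show ?thesis
    unfolding compact_space_alt
  proof (intro allI impI)
    fix \<U> assume \<U>: "(\<forall>U\<in>\<U>. openin (orbit_space c \<alpha> \<Gamma>) U) \<and> topspace (orbit_space c \<alpha> \<Gamma>) \<subseteq> \<Union>\<U>"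
    have "?R \<subseteq> \<Union>\<U>"
      using \<U> by (simp add: space)
    then have "\<Union>?R \<subseteq> \<Union>(\<Union>\<U>)"
      by (rule Union_mono)
    then have "x \<in> (\<Union>U\<in>\<U>. \<Union>U)" for x
      unfolding union by blast
    then have cover: "fund_domain \<subseteq> (\<Union>U\<in>\<U>. \<Union>U)"
      by (rule subsetI)
    have opens: "U \<subseteq> ?R" "open (\<Union>U)" if "U \<in> \<U>" for U
      using that \<U> by (simp_all add: openin)
    obtain \<F> where \<F>: "\<F> \<subseteq> \<U>" "finite \<F>" "fund_domain \<subseteq> (\<Union>U\<in>\<F>. \<Union>U)"
      by (rule compactE_image[OF compact_fund_domain opens(2) cover])
    have "C \<in> \<Union>\<F>" if "C \<in> ?R" for C
    proof -
      obtain x where C: "C = \<Gamma> #>\<^bsub>G\<^esub> x"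
        using \<open>C \<in> ?R\<close> by (auto simp: RCOSETS_def)
      obtain \<gamma> where \<gamma>: "\<gamma> \<in> \<Gamma>" "solv_mult c \<alpha> \<gamma> x \<in> fund_domain"
        using fund_domain_meets_orbits by blast
      then have "solv_mult c \<alpha> \<gamma> x \<in> C"
        by (auto simp: C r_coset_def solv_group_def)
      moreover obtain U C' where "U \<in> \<F>" "C' \<in> U" "solv_mult c \<alpha> \<gamma> x \<in> C'"
        using \<gamma> \<F> by blast
      moreover have "C' \<in> ?R"
        using \<open>U \<in> \<F>\<close> \<open>C' \<in> U\<close> \<F>(1) opens(1) by blast
      ultimately show ?thesis
        using disj[OF that] by blast
    qed
    then show "\<exists>\<F>. finite \<F> \<and> \<F> \<subseteq> \<U> \<and> topspace (orbit_space c \<alpha> \<Gamma>) \<subseteq> \<Union>\<F>"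
      unfolding space using \<F> by blast
  qed
qed

end

section \<open>The torsion class\<close>

lemma integral_derivative_periodic_real:
  fixes g F :: "real \<Rightarrow> real"
  assumes deriv: "\<And>s. (g has_real_derivative F s) (at s)" and per: "g 1 = g 0"
  shows "integral (cbox 0 1) F = 0"
proof -
  have "(F has_integral g 1 - g 0) {0..1}"
    by (rule fundamental_theorem_of_calculus)
      (auto simp flip: has_real_derivative_iff_has_vector_derivative intro: deriv has_field_derivative_at_within)
  then show ?thesis
    by (simp add: per integral_unique)
qed

text \<open>Fubini puts the periodic variable innermost, where the fundamental theorem of calculus
  leaves g 1 y - g 0 y = 0.\<close>

lemma integral_derivative_periodic:
  fixes g F :: "real \<Rightarrow> 'b::euclidean_space \<Rightarrow> real"
  assumes cont: "continuous_on UNIV (\<lambda>(s, y). F s y)"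
    and deriv: "\<And>s y. ((\<lambda>s. g s y) has_real_derivative F s y) (at s)"
    and per: "\<And>y. g 1 y = g 0 y"
  shows "integral (cbox (0, a) (1, b)) (\<lambda>(s, y). F s y) = 0"
proof -
  have "integral (cbox 0 1) (\<lambda>s. F s y) = 0" for y
    using deriv per by (rule integral_derivative_periodic_real)
  moreover have cont': "continuous_on (cbox (0, a) (1, b)) (\<lambda>(s, y). F s y)"
    using cont by (rule continuous_on_subset) simp
  ultimately show ?thesis
    using integral_swap_continuous[OF cont'] integral_prod_continuous[OF cont'] by simp
qed

text \<open>Stokes' theorem on the torus spanned by v1, v2, v3: the 2-form with components f1, f2, f3
  has exterior derivative of mean value 0.\<close>

lemma periodic_divergence_const_imp_zero:
  fixes f1 f2 f3 :: "'a::euclidean_space \<Rightarrow> real" and v1 v2 v3 :: 'a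
  assumes smooth: "smooth f1" "smooth f2" "smooth f3"
    and per: "\<And>x. f1 (x + v1) = f1 x" "\<And>x. f2 (x + v2) = f2 x" "\<And>x. f3 (x + v3) = f3 x"
    and div: "\<And>x. frechet_derivative f1 (at x) v1 - frechet_derivative f2 (at x) v2
      + frechet_derivative f3 (at x) v3 = k"
  shows "k = 0"
proof -
  define D where "D f v x = frechet_derivative f (at x) v" for f :: "'a \<Rightarrow> real" and v x
  have cont_D: "continuous_on S (\<lambda>y. D f v (h y))" if "smooth f" "continuous_on S h"
    for S f v and h :: "'c::topological_space \<Rightarrow> 'a"
    unfolding D_def
    using continuous_on_compose2[OF smooth_continuous_on_frechet_derivative[OF that(1)] that(2)] by simp
  have deriv: "((\<lambda>s. f (s *\<^sub>R v + q)) has_real_derivative D f v (s *\<^sub>R v + q)) (at s)"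
    if "smooth f" for f v q s
  proof -
    have "((\<lambda>s. s *\<^sub>R v + q) has_derivative (\<lambda>h. h *\<^sub>R v)) (at s)"
      by (auto intro!: derivative_eq_intros)
    from has_derivative_compose[OF this smooth_has_derivative[OF that]]
    have "((\<lambda>s. f (s *\<^sub>R v + q)) has_derivative
        (\<lambda>h. frechet_derivative f (at (s *\<^sub>R v + q)) (h *\<^sub>R v))) (at s)" .
    moreover have "frechet_derivative f (at x) (h *\<^sub>R v) = D f v x * h" for x h
      unfolding D_def
      using linear_scale[OF has_derivative_linear[OF smooth_has_derivative[OF that]], of x h v] by simp
    ultimately show ?thesis
      by (simp add: has_field_derivative_def)
  qed
  define P where "P s = fst s *\<^sub>R v1 + (fst (snd s) *\<^sub>R v2 + snd (snd s) *\<^sub>R v3)" for s :: "real \<times> real \<times> real"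
  let ?C = "cbox (0, 0, 0) (1, 1, 1) :: (real \<times> real \<times> real) set"
  have cont_P: "continuous_on S P" for S
    unfolding P_def by (intro continuous_intros)
  have int: "(\<lambda>s. D f v (P s)) integrable_on ?C" if "smooth f" for f v
    by (intro integrable_continuous cont_D that cont_P)
  \<comment> \<open>Each term integrates to zero along its own edge of the cube. The three cases
    differ only in whether that variable is outermost, middle or innermost in the nested
    product.\<close>
  have i1: "integral ?C (\<lambda>s. D f1 v1 (P s)) = 0"
  proof -
    have "continuous_on UNIV (\<lambda>(s, y). D f1 v1 (P (s, y)))"
      unfolding case_prod_unfold by (intro cont_D smooth) (simp add: cont_P)
    moreover have "((\<lambda>s. f1 (P (s, y))) has_real_derivative D f1 v1 (P (s, y))) (at s)" for s y
      unfolding P_def fst_conv snd_conv by (rule deriv[OF smooth(1)])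
    moreover have "f1 (P (1, y)) = f1 (P (0, y))" for y
      using per(1)[of "P (0, y)"] by (simp add: P_def ac_simps)
    ultimately show ?thesis
      using integral_derivative_periodic[of "\<lambda>s y. D f1 v1 (P (s, y))" "\<lambda>s y. f1 (P (s, y))" "(0, 0)" "(1, 1)"]
      by (simp add: case_prod_unfold)
  qed
  have i2: "integral ?C (\<lambda>s. D f2 v2 (P s)) = 0"
  proof -
    have inner: "integral (cbox (0, 0) (1, 1)) (\<lambda>(t, y). D f2 v2 (P (s, t, y))) = 0" for s
    proof (rule integral_derivative_periodic)
      show "continuous_on UNIV (\<lambda>(t, y). D f2 v2 (P (s, t, y)))"
        unfolding case_prod_unfold P_def fst_conv snd_conv by (intro cont_D smooth continuous_intros)
      have eq: "P (s, t, y) = t *\<^sub>R v2 + (s *\<^sub>R v1 + y *\<^sub>R v3)" for t y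
        by (simp add: P_def)
      show "((\<lambda>t. f2 (P (s, t, y))) has_real_derivative D f2 v2 (P (s, t, y))) (at t)" for t y
        unfolding eq by (rule deriv[OF smooth(2)])
      show "f2 (P (s, 1, y)) = f2 (P (s, 0, y))" for y
        using per(2)[of "P (s, 0, y)"] by (simp add: eq ac_simps)
    qed
    show ?thesis
      using inner by (subst integral_prod_continuous)
        (auto intro!: cont_D smooth cont_P simp: case_prod_unfold)
  qed
  have i3: "integral ?C (\<lambda>s. D f3 v3 (P s)) = 0"
  proof -
    have eq: "P (s, t, y) = y *\<^sub>R v3 + (s *\<^sub>R v1 + t *\<^sub>R v2)" for s t y
      by (simp add: P_def)
    have inner: "integral (cbox 0 1) (\<lambda>y. D f3 v3 (P (s, t, y))) = 0" for s t
    proof (rule integral_derivative_periodic_real)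
      show "((\<lambda>y. f3 (P (s, t, y))) has_real_derivative D f3 v3 (P (s, t, y))) (at y)" for y
        unfolding eq by (rule deriv[OF smooth(3)])
      show "f3 (P (s, t, 1)) = f3 (P (s, t, 0))"
        using per(3)[of "P (s, t, 0)"] by (simp add: eq ac_simps)
    qed
    have "integral (cbox (0, 0) (1, 1)) (\<lambda>y. D f3 v3 (P (s, y))) = 0" for s
      using inner by (subst integral_prod_continuous) (auto intro!: cont_D smooth continuous_intros simp: P_def)
    then show ?thesis
      by (subst integral_prod_continuous) (auto intro!: cont_D smooth cont_P)
  qed
  have "integral ?C (\<lambda>s. k) = integral ?C (\<lambda>s. D f1 v1 (P s) - D f2 v2 (P s) + D f3 v3 (P s))"
    using div by (simp add: D_def)
  also have "\<dots> = 0"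
    by (simp add: integral_add integral_diff integrable_diff int smooth i1 i2 i3)
  finally show ?thesis
    by (simp add: content_Pair)
qed

text \<open>\<open>twisted\<close> asks for a real form, whereas \<open>dc\<close> takes complex
  values; this is the real form behind it. It ignores the base point, whence its closedness.\<close>

definition solv_torsion :: "real \<Rightarrow> (E6, real) form" where
  "solv_torsion s x vs =
     (case vs of [u, v, w] \<Rightarrow> s * wedge3 pu (\<lambda>v. Re (pz v)) (\<lambda>v. Im (pz v)) u v w | _ \<Rightarrow> 0)"

lemma complexify_solv_torsion:
  assumes "a \<noteq> 0" "s\<^sup>2 = 1"
  shows "complexify (solv_torsion s) = dc (solv_J a s) 2 (fundamental_form (solv_metric a) (solv_J a s))"
  unfolding fun_eq_iff complexify_def dc_fundamental_form_solv[OF assms] solv_torsion_def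
  by (simp split: list.split)

lemma ext_deriv_solv_torsion:
  "ext_deriv (solv_torsion s) = (\<lambda>x vs. 0)" "ext_deriv (complexify (solv_torsion s)) = (\<lambda>x vs. 0)"
proof -
  have "solv_torsion s = (\<lambda>x. solv_torsion s 0)"
    "complexify (solv_torsion s) = (\<lambda>x. complexify (solv_torsion s) 0)"
    by (simp_all add: fun_eq_iff complexify_def solv_torsion_def)
  then show "ext_deriv (solv_torsion s) = (\<lambda>x vs. 0)" "ext_deriv (complexify (solv_torsion s)) = (\<lambda>x vs. 0)"
    using ext_deriv_const by metis+
qed

lemma alternating_solv_torsion: "alternating 3 (solv_torsion s x)"
proof -
  have len3: "\<exists>u v w. vs = [u, v, w]" if "length vs = 3" for vs :: "E6 list"
    using that by (auto simp: numeral_3_eq_3 length_Suc_conv)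
  have lt3: "i = 0 \<or> i = 1 \<or> i = 2" if "i < 3" for i :: nat
    using that by auto
  show ?thesis
    unfolding alternating_def
  proof (intro conjI allI impI)
    fix vs :: "E6 list" assume "length vs \<noteq> 3"
    then show "solv_torsion s x vs = 0"
      by (auto simp: solv_torsion_def split: list.split)
  next
    fix vs :: "E6 list" and i :: nat assume i: "length vs = 3 \<and> i < 3"
    then obtain u v w where vs: "vs = [u, v, w]" using len3 by blast
    from i have "i = 0 \<or> i = 1 \<or> i = 2" using lt3 by blast
    then show "linear (\<lambda>v. solv_torsion s x (vs[i := v]))"
      by (elim disjE; hypsubst; unfold vs)
        (rule linearI; simp add: solv_torsion_def wedge3_def algebra_simps)+
  next
    fix vs :: "E6 list" and i j :: nat assume ij: "length vs = 3 \<and> i < j \<and> j < 3 \<and> vs ! i = vs ! j"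
    then obtain u v w where vs: "vs = [u, v, w]" using len3 by blast
    from ij have "i = 0 \<and> j = 1 \<or> i = 0 \<and> j = 2 \<or> i = 1 \<and> j = 2" by auto
    then have "u = v \<or> u = w \<or> v = w" using ij vs by auto
    then show "solv_torsion s x vs = 0"
      by (auto simp: vs solv_torsion_def wedge3_def algebra_simps)
  qed
qed

lemma nontrivial_solv_J: "nontrivial_pair (solv_J a 1) (solv_J a (- 1))"
proof -
  \<comment> \<open>The structures are opposite on the z factor and equal on the w factor: the first
    fact excludes equality, the second excludes opposite signs.\<close>
  have "solv_J a (- 1) 0 (0, 0, 1, 0) \<noteq> solv_J a 1 0 (0, 0, 1, 0)"
    "solv_J a (- 1) 0 (0, 0, 0, 1) \<noteq> - solv_J a 1 0 (0, 0, 0, 1)"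
    by (simp_all add: solv_J_def complex_eq_iff)
  then show ?thesis
    unfolding nontrivial_pair_def by (metis)
qed

context solv_lattice_data
begin

abbreviation "deck \<equiv> left_translations c \<alpha> \<Gamma>"

lemma solv_torsion_closed: "solv_torsion s \<in> closed_forms deck 3"
proof -
  have rot: "Re (k * z) * Im (k * z') - Im (k * z) * Re (k * z') = (cmod k)\<^sup>2 * (Re z * Im z' - Im z * Re z')"
    for k z z'
    by (simp add: cmod_power2) (simp add: power2_eq_square algebra_simps)
  have wedge: "wedge3 pu (\<lambda>v. Re (pz v)) (\<lambda>v. Im (pz v))
      (pt u, c powr t * pu u, \<alpha> powr of_real t * pz u, k * pw u)
      (pt v, c powr t * pu v, \<alpha> powr of_real t * pz v, k * pw v)
      (pt w, c powr t * pu w, \<alpha> powr of_real t * pz w, k * pw w)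
    = wedge3 pu (\<lambda>v. Re (pz v)) (\<lambda>v. Im (pz v)) u v w" for t k u v w
  proof -
    \<comment> \<open>Unimodularity on (u, z): the factors by which a translation scales du and the
      area form dx dy are reciprocal.\<close>
    have "c powr t * (cmod (\<alpha> powr of_real t))\<^sup>2 = 1"
      unfolding norm_powr_of_real_sq[OF c_gt_1 norm_\<alpha>]
      using c_gt_1 by (simp add: powr_def mult.commute exp_minus)
    then have cancel: "c powr t * x * ((cmod (\<alpha> powr of_real t))\<^sup>2 * y) = x * y" for x y
      by (metis mult.assoc mult.commute mult.left_neutral)
    show ?thesis
      unfolding wedge3_def fst_conv snd_conv rot cancel ..
  qed
  have "pullback (solv_mult c \<alpha> p) (solv_torsion s) x vs = solv_torsion s x vs" for p x vs
    by (simp add: pullback_def solv_torsion_def frechet_derivative_solv_mult wedge del: split_paired_All split: list.split)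
  then have "pullback \<phi> (solv_torsion s) = solv_torsion s" if "\<phi> \<in> deck" for \<phi>
    using that unfolding left_translations_def by blast
  then show ?thesis
    by (simp add: closed_forms_def quotient_forms_def alternating_solv_torsion ext_deriv_solv_torsion)
      (simp add: solv_torsion_def)
qed

lemma solv_torsion_not_exact:
  assumes "s \<noteq> 0"
  shows "solv_torsion s \<notin> exact_forms deck 3"
proof
  assume "solv_torsion s \<in> exact_forms deck 3"
  then obtain \<eta> where \<eta>: "\<eta> \<in> quotient_forms deck 2" and d: "solv_torsion s = ext_deriv \<eta>"
    by (auto simp: exact_forms_def numeral_3_eq_3 numeral_2_eq_2)
  define b where "b j = (0::real, cv $ j, \<alpha>v $ j, 0::complex)" for j
  \<comment> \<open>Left translation by \<open>b j\<close> is an ordinary translation with identity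
    differential, so invariance of \<eta> becomes periodicity of its components.\<close>
  have per: "\<eta> (x + b j) vs = \<eta> x vs" for x j vs
  proof -
    have "b j \<in> \<Gamma>"
      unfolding b_def by (rule \<Gamma>_generator) (simp add: lattice_generators_def)
    then have "pullback (solv_mult c \<alpha> (b j)) \<eta> = \<eta>"
      using \<eta> by (simp add: quotient_forms_def left_translations_def)
    then have "\<eta> (solv_mult c \<alpha> (b j) x) (map (frechet_derivative (solv_mult c \<alpha> (b j)) (at x)) vs) = \<eta> x vs"
      by (metis pullback_def)
    moreover have "frechet_derivative (solv_mult c \<alpha> (b j)) (at x) = (\<lambda>v. v)"
      using c_gt_1 \<alpha>_nz by (simp add: frechet_derivative_solv_mult b_def)
    moreover have "solv_mult c \<alpha> (b j) x = x + b j"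
      using c_gt_1 \<alpha>_nz by (simp add: solv_mult_eq b_def prod_eq_iff)
    ultimately show ?thesis by simp
  qed
  \<comment> \<open>On the lattice vectors d\<eta> is the divergence of three periodic functions,
    and the torsion is s times the signed covolume of the lattice they span in R x C. Its mean value
    cannot vanish.\<close>
  have "frechet_derivative (\<lambda>y. \<eta> y [b 2, b 3]) (at x) (b 1) - frechet_derivative (\<lambda>y. \<eta> y [b 1, b 3]) (at x) (b 2)
      + frechet_derivative (\<lambda>y. \<eta> y [b 1, b 2]) (at x) (b 3) = s * det basis_matrix" for x
    using fun_cong[OF fun_cong[OF d], of x "[b 1, b 2, b 3]"]
    by (simp add: ext_deriv_three solv_torsion_def wedge3_def b_def basis_matrix_def det_3 algebra_simps)
  then have "s * det basis_matrix = 0"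
    using \<eta> per
    by (intro periodic_divergence_const_imp_zero[where ?v1.0 = "b 1" and ?v2.0 = "b 2" and ?v3.0 = "b 3"
          and ?f1.0 = "\<lambda>x. \<eta> x [b 2, b 3]" and ?f2.0 = "\<lambda>x. \<eta> x [b 1, b 3]"
          and ?f3.0 = "\<lambda>x. \<eta> x [b 1, b 2]"])
      (simp_all add: quotient_forms_def)
  then show False
    using assms det_basis_matrix by simp
qed

lemma generalized_kahler_solv: "generalized_kahler deck (solv_J (ln c) 1) (solv_J (ln c) (- 1)) (solv_metric (ln c))"
proof -
  have a: "ln c \<noteq> 0" using c_gt_1 by simp
  have inv: "left_invariant c \<alpha> (solv_J (ln c) 1) (solv_J (ln c) (- 1)) (solv_metric (ln c))"
    by (rule left_invariant_solv[OF c_gt_1 norm_\<alpha>])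
  have "deck \<subseteq> left_translations c \<alpha> UNIV"
    by (auto simp: left_translations_def)
  with inv have "invariant_endo deck (solv_J (ln c) 1)" "invariant_endo deck (solv_J (ln c) (- 1))"
    "invariant_metric deck (solv_metric (ln c))"
    unfolding left_invariant_def invariant_endo_def invariant_metric_def Let_def by blast+
  moreover note integrable_solv_J[OF a] riemannian_solv_metric[OF a] hermitian_solv_J[OF a]
  moreover have "solv_torsion (- 1) x vs = - solv_torsion 1 x vs" for x vs
    by (simp add: solv_torsion_def split: list.split)
  ultimately show ?thesis
    unfolding generalized_kahler_def
    by (simp add: complexify_solv_torsion[OF a, symmetric] ext_deriv_solv_torsion)
      (simp add: complexify_def)
qed

lemma twisted_solv: "twisted deck (solv_J (ln c) 1) (solv_metric (ln c))"
  unfolding twisted_def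
  using solv_torsion_closed[of 1] solv_torsion_not_exact[of 1] complexify_solv_torsion[of "ln c" 1] c_gt_1
  by (intro bexI[of _ "solv_torsion 1"]) simp_all

end

theorem theorem3p5:
  fixes m :: "int^3^3" and c :: real and \<alpha> :: complex
    and cv :: "real^3" and \<alpha>v :: "complex^3"
  assumes "det m = 1"
    and "\<alpha> \<notin> \<real>"
    and "c > 1" and "c \<notin> \<rat>"
    and "(cmod \<alpha>)\<^sup>2 * c = 1"
    and "\<alpha>v \<noteq> 0" and "\<And>j. \<alpha> * \<alpha>v $ j = (\<Sum>k\<in>UNIV. of_int (m $ j $ k) * \<alpha>v $ k)"
    and "cv \<noteq> 0" and "\<And>j. c * cv $ j = (\<Sum>k\<in>UNIV. of_int (m $ j $ k) * cv $ k)"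
  shows "discrete (solv_lattice c \<alpha> cv \<alpha>v) \<and>
    compact_space (orbit_space c \<alpha> (solv_lattice c \<alpha> cv \<alpha>v)) \<and>
    (\<exists>Jp Jm g.
      left_invariant c \<alpha> Jp Jm g \<and>
      generalized_kahler (left_translations c \<alpha> (solv_lattice c \<alpha> cv \<alpha>v)) Jp Jm g \<and>
      nontrivial_pair Jp Jm \<and>
      twisted (left_translations c \<alpha> (solv_lattice c \<alpha> cv \<alpha>v)) Jp g)"
proof -
  interpret solv_lattice_data m c \<alpha> cv \<alpha>v
    using assms by unfold_locales
  show ?thesis
    using discrete_\<Gamma> compact_orbit_space left_invariant_solv[OF c_gt_1 norm_\<alpha>]
      generalized_kahler_solv nontrivial_solv_J twisted_solv by blast
qed

end
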